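(* There exists a universal constant $c_{\mathrm{abs}}>0$ such that the following holds. Let $\Phi:\mathbb M_d\to\mathbb M_d$ be a unital, completely positive, trace-preserving map with unique fixed point state $\mathbf 1/d$. Let $|||\cdot|||_L$ be a commutator semi-norm on $\mathbb M_d$ given by a finite resource set $\mathcal S\subseteq\mathbb M_d$ such that $\Phi^*\circ E=E$, where $E$ is the conditional expectation onto $\mathcal S'$, and suppose $\mathrm{Lip}_L(\Phi)<1$ and $\mathrm{Lip}_L(\Phi^* )\le1$. Then for every $\varepsilon\in(0,1)$, $$t_{\mathrm{mix}}(\varepsilon,\Phi)\le c_{\mathrm{abs}}\,\frac{\log(1/\varepsilon)+\log d}{-\log\bigl(\mathrm{Lip}_L(\Phi)\bigr)-\log\bigl(\mathrm{Lip}_L(\Phi^* )\bigr)}.$$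
   Context: $\Phi^*$ is the Hilbert–Schmidt adjoint of $\Phi$. The commutator semi-norm of a finite set $\mathcal S\subseteq\mathbb M_d$ is $|||x|||_L=\sup_{s\in\mathcal S}\|[s,x]\|_{op}$; it is assumed that the commutant $\mathcal S'$ is a von Neumann subalgebra and a conditional expectation $E:\mathbb M_d\to\mathcal S'$ is fixed. For a linear map $\Psi$ on $\mathbb M_d$, $\mathrm{Lip}_L(\Psi)=\sup\{|||\Psi(x)|||_L: x=x^*,\ |||x|||_L\le1\}$. The mixing time is $$t_{\mathrm{mix}}(\varepsilon,\Phi)=\inf\{n\ge1: \|\Phi^n(\rho)-\mathbf 1/d\|_1\le\varepsilon\ \text{ for all density matrices }\rho\},$$ with $\|\cdot\|_1$ the trace norm.
   Formalization: The bound is proved as t_mix ≤ max(1, c_abs·fraction): since t_mix is an infimum over n ≥ 1 it is at least 1, while the fraction can be arbitrarily small (e.g. depolarizing channels on M_2), so the bound without the maximum fails for every constant. *)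

theory Defs
  imports
    "Jordan_Normal_Form.Spectral_Radius"
    "HOL-Library.Extended_Real"
begin

text \<open>
  \<open>\<bbbM>\<^sub>d\<close> is rendered as \<open>carrier_mat d d\<close>, and a map on \<open>\<bbbM>\<^sub>d\<close> as a function
  \<open>complex mat \<Rightarrow> complex mat\<close> whose values outside \<open>carrier_mat d d\<close> are never used.
\<close>

definition linear_on_mats :: "nat \<Rightarrow> (complex mat \<Rightarrow> complex mat) \<Rightarrow> bool" where
  "linear_on_mats d \<Phi> \<longleftrightarrow>
     (\<forall>x\<in>carrier_mat d d. \<Phi> x \<in> carrier_mat d d) \<and>
     (\<forall>x\<in>carrier_mat d d. \<forall>y\<in>carrier_mat d d. \<Phi> (x + y) = \<Phi> x + \<Phi> y) \<and>
     (\<forall>a. \<forall>x\<in>carrier_mat d d. \<Phi> (a \<cdot>\<^sub>m x) = a \<cdot>\<^sub>m \<Phi> x)"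

definition self_adjoint :: "complex mat \<Rightarrow> bool" where
  "self_adjoint x \<longleftrightarrow> mat_adjoint x = x"

text \<open>The order on \<^typ>\<open>complex\<close> is that of \<open>Complex_Order\<close>: \<open>0 \<le> z\<close> says that \<open>z\<close> is real
  and nonnegative. Over the complex numbers the condition below thus includes self-adjointness.\<close>

definition psd :: "nat \<Rightarrow> complex mat \<Rightarrow> bool" where
  "psd d x \<longleftrightarrow> x \<in> carrier_mat d d \<and> (\<forall>v\<in>carrier_vec d. 0 \<le> (x *\<^sub>v v) \<bullet>c v)"

definition mat_trace :: "complex mat \<Rightarrow> complex" where
  "mat_trace x = (\<Sum>i<dim_row x. x $$ (i, i))"

definition density_matrix :: "nat \<Rightarrow> complex mat \<Rightarrow> bool" where
  "density_matrix d \<rho> \<longleftrightarrow> psd d \<rho> \<and> mat_trace \<rho> = 1"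

definition maximally_mixed :: "nat \<Rightarrow> complex mat" where
  "maximally_mixed d = (1 / of_nat d) \<cdot>\<^sub>m 1\<^sub>m d"

definition vec_l2 :: "complex vec \<Rightarrow> real" where
  "vec_l2 v = sqrt (Re (v \<bullet>c v))"

definition op_norm :: "complex mat \<Rightarrow> real" where
  "op_norm x = Sup {vec_l2 (x *\<^sub>v v) | v. v \<in> carrier_vec (dim_col x) \<and> vec_l2 v \<le> 1}"

text \<open>The sum of the singular values, i.e. of the square roots of the eigenvalues of \<open>x\<^sup>* x\<close>,
  each repeated according to its algebraic multiplicity. These eigenvalues are real and
  nonnegative, so \<^const>\<open>Re\<close> loses nothing.\<close>

definition trace_norm :: "complex mat \<Rightarrow> real" where
  "trace_norm x =
     (let y = mat_adjoint x * x in
       \<Sum>z\<in>spectrum y. of_nat (Polynomial.order z (char_poly y)) * sqrt (Re z))"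

text \<open>A matrix of size \<open>k d\<close> is read as a \<open>k \<times> k\<close> array of \<open>d \<times> d\<close> blocks;
  \<open>id\<^sub>k \<otimes> \<Phi>\<close> applies \<open>\<Phi>\<close> to each block.\<close>

definition mat_block :: "nat \<Rightarrow> nat \<Rightarrow> nat \<Rightarrow> complex mat \<Rightarrow> complex mat" where
  "mat_block d p q X = mat d d (\<lambda>(a, b). X $$ (p * d + a, q * d + b))"

definition amplification ::
    "nat \<Rightarrow> nat \<Rightarrow> (complex mat \<Rightarrow> complex mat) \<Rightarrow> complex mat \<Rightarrow> complex mat" where
  "amplification k d \<Phi> X = mat (k * d) (k * d)
     (\<lambda>(i, j). \<Phi> (mat_block d (i div d) (j div d) X) $$ (i mod d, j mod d))"

definition completely_positive :: "nat \<Rightarrow> (complex mat \<Rightarrow> complex mat) \<Rightarrow> bool" where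
  "completely_positive d \<Phi> \<longleftrightarrow> linear_on_mats d \<Phi> \<and>
     (\<forall>k X. psd (k * d) X \<longrightarrow> psd (k * d) (amplification k d \<Phi> X))"

definition trace_preserving :: "nat \<Rightarrow> (complex mat \<Rightarrow> complex mat) \<Rightarrow> bool" where
  "trace_preserving d \<Phi> \<longleftrightarrow> (\<forall>x\<in>carrier_mat d d. mat_trace (\<Phi> x) = mat_trace x)"

definition unital :: "nat \<Rightarrow> (complex mat \<Rightarrow> complex mat) \<Rightarrow> bool" where
  "unital d \<Phi> \<longleftrightarrow> \<Phi> (1\<^sub>m d) = 1\<^sub>m d"

definition unique_fixed_state :: "nat \<Rightarrow> (complex mat \<Rightarrow> complex mat) \<Rightarrow> complex mat \<Rightarrow> bool" where
  "unique_fixed_state d \<Phi> \<sigma> \<longleftrightarrow> (\<forall>\<rho>. density_matrix d \<rho> \<and> \<Phi> \<rho> = \<rho> \<longleftrightarrow> \<rho> = \<sigma>)"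

definition hs_inner :: "complex mat \<Rightarrow> complex mat \<Rightarrow> complex" where
  "hs_inner x y = mat_trace (mat_adjoint x * y)"

text \<open>This determines the adjoint \<open>\<Psi>\<close> of \<open>\<Phi>\<close> uniquely on \<open>carrier_mat d d\<close>.\<close>

definition is_hs_adjoint ::
    "nat \<Rightarrow> (complex mat \<Rightarrow> complex mat) \<Rightarrow> (complex mat \<Rightarrow> complex mat) \<Rightarrow> bool" where
  "is_hs_adjoint d \<Phi> \<Psi> \<longleftrightarrow> linear_on_mats d \<Psi> \<and>
     (\<forall>x\<in>carrier_mat d d. \<forall>y\<in>carrier_mat d d. hs_inner (\<Psi> x) y = hs_inner x (\<Phi> y))"

definition commutant :: "nat \<Rightarrow> complex mat set \<Rightarrow> complex mat set" where
  "commutant d S = {x \<in> carrier_mat d d. \<forall>s\<in>S. s * x = x * s}"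

text \<open>In finite dimension a unital *-subalgebra is automatically closed, so no topological
  condition is needed.\<close>

definition von_neumann_subalgebra :: "nat \<Rightarrow> complex mat set \<Rightarrow> bool" where
  "von_neumann_subalgebra d N \<longleftrightarrow> N \<subseteq> carrier_mat d d \<and> 1\<^sub>m d \<in> N \<and>
     (\<forall>x\<in>N. \<forall>y\<in>N. x + y \<in> N \<and> x * y \<in> N) \<and>
     (\<forall>a. \<forall>x\<in>N. a \<cdot>\<^sub>m x \<in> N) \<and>
     (\<forall>x\<in>N. mat_adjoint x \<in> N)"

definition conditional_expectation ::
    "nat \<Rightarrow> complex mat set \<Rightarrow> (complex mat \<Rightarrow> complex mat) \<Rightarrow> bool" where
  "conditional_expectation d N E \<longleftrightarrow> linear_on_mats d E \<and>
     (\<forall>x\<in>carrier_mat d d. E x \<in> N) \<and>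
     (\<forall>a\<in>N. E a = a) \<and>
     (\<forall>x. psd d x \<longrightarrow> psd d (E x)) \<and>
     (\<forall>a\<in>N. \<forall>b\<in>N. \<forall>x\<in>carrier_mat d d. E (a * x * b) = a * E x * b)"

text \<open>The inserted \<open>0\<close> only matters for \<open>S = {}\<close>, where the supremum of the empty set of
  norms is \<open>0\<close>.\<close>

definition comm_seminorm :: "complex mat set \<Rightarrow> complex mat \<Rightarrow> real" where
  "comm_seminorm S x = Sup (insert 0 ((\<lambda>s. op_norm (s * x - x * s)) ` S))"

text \<open>Extended real valued, because the semi-norm has a kernel and a general map may send
  that kernel outside of itself.\<close>

definition Lip :: "nat \<Rightarrow> complex mat set \<Rightarrow> (complex mat \<Rightarrow> complex mat) \<Rightarrow> ereal" where
  "Lip d S \<Psi> =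
     Sup {ereal (comm_seminorm S (\<Psi> x)) | x.
            x \<in> carrier_mat d d \<and> self_adjoint x \<and> comm_seminorm S x \<le> 1}"

text \<open>The natural logarithm on \<open>[0, \<infinity>]\<close> with \<open>log 0 = -\<infinity>\<close> (unlike \<^term>\<open>ln (0::real) = 0\<close>).\<close>

definition elog :: "ereal \<Rightarrow> ereal" where
  "elog x = (if x \<le> 0 then -\<infinity> else if x = \<infinity> then \<infinity> else ereal (ln (real_of_ereal x)))"

text \<open>The infimum is taken in \<open>[0, \<infinity>]\<close>: it is \<open>\<infinity>\<close> if no \<open>n\<close> is admissible.\<close>

definition t_mix :: "nat \<Rightarrow> real \<Rightarrow> (complex mat \<Rightarrow> complex mat) \<Rightarrow> ereal" where
  "t_mix d \<epsilon> \<Phi> =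
     Inf {ereal (real n) | n. n \<ge> 1 \<and>
            (\<forall>\<rho>. density_matrix d \<rho> \<longrightarrow> trace_norm ((\<Phi> ^^ n) \<rho> - maximally_mixed d) \<le> \<epsilon>)}"

end

theory Submission
  imports Defs "HOL-Analysis.L2_Norm"
begin

text \<open>
  Elements of \<open>\<S>'\<close> are fixed by \<open>\<Phi>\<^sup>*\<close>, hence by \<open>\<Phi>\<close>, because \<open>\<Phi>\<close> contracts the
  Hilbert--Schmidt norm; so the self-adjoint ones are scalar, and on traceless self-adjoint
  matrices the commutator semi-norm is a norm that dominates the Hilbert--Schmidt norm up to a
  constant. With \<open>T = \<Phi>\<^sup>* \<Phi>\<close> and \<open>q = Lip(\<Phi>) Lip(\<Phi>\<^sup>*)\<close> the orbit \<open>T\<^sup>n x\<close> thus decays like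
  \<open>C q\<^sup>n\<close> in Hilbert--Schmidt norm. As \<open>T\<close> is self-adjoint, the norms of \<open>T\<^sup>n x\<close> are log-convex,
  which removes the constant: \<open>\<Phi>\<close> contracts traceless self-adjoint matrices by \<open>\<surd>q\<close>. The trace
  norm costs a factor \<open>\<surd>d\<close>, and so does the Hilbert--Schmidt norm of the initial state.
\<close>

section \<open>The Hilbert--Schmidt inner product\<close>

text \<open>The obstacle is that the constant comparing the semi-norm with the Hilbert-Schmidt norm
  comes from compactness and depends on \<open>S\<close> and \<open>d\<close>, whereas
  \<open>c_abs\<close> must be universal. Iterating the Lipschitz bound of \<open>\<Phi>\<close>
  alone would keep that constant. For the self-adjoint map \<open>T\<close> it disappears, because
  the asymptotic decay rate of an orbit already bounds its first step. One application of
  \<open>T\<close> picks up both Lipschitz factors, and |\<Phi> x|^2 = <T x, x> turns this into a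
  factor sqrt q for each step of \<open>\<Phi>\<close>; hence the sum of two logarithms in the
  denominator. The two factors sqrt d lead to the condition d q^(n/2) \<le> \<epsilon>, which holds
  once n \<ge> 2 (log(1/\<epsilon>) + log d) / (- log q). Rounding n up to an integer costs at most
  another factor 2 unless n = 1 suffices, so \<open>c_abs\<close> is 4.\<close>

lemma dim_mat_adjoint [simp]:
  "dim_row (mat_adjoint A) = dim_col A" "dim_col (mat_adjoint A) = dim_row A"
  by (auto simp: mat_adjoint_def)

lemma index_mat_adjoint [simp]:
  "i < dim_col A \<Longrightarrow> j < dim_row A \<Longrightarrow> mat_adjoint A $$ (i, j) = conjugate (A $$ (j, i))"
  by (simp add: mat_adjoint_def mat_of_rows_index)

lemma mat_adjoint_carrier [simp]:
  "A \<in> carrier_mat n m \<Longrightarrow> mat_adjoint A \<in> carrier_mat m n"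
  by (metis carrier_matD carrier_matI dim_mat_adjoint)

lemma self_adjoint_iff:
  assumes "x \<in> carrier_mat d d"
  shows "self_adjoint x \<longleftrightarrow> (\<forall>i<d. \<forall>j<d. cnj (x $$ (j, i)) = x $$ (i, j))"
  using assms unfolding self_adjoint_def mat_eq_iff by simp

lemma hs_inner_eq_sum:
  assumes "x \<in> carrier_mat n m" "y \<in> carrier_mat n m"
  shows "hs_inner x y = (\<Sum>(i, j)\<in>{..<n} \<times> {..<m}. cnj (x $$ (i, j)) * y $$ (i, j))"
proof -
  have "hs_inner x y = (\<Sum>j<m. \<Sum>i<n. cnj (x $$ (i, j)) * y $$ (i, j))"
    using assms unfolding hs_inner_def mat_trace_def
    by (intro sum.cong) (auto simp: scalar_prod_def atLeast0LessThan)
  also have "\<dots> = (\<Sum>i<n. \<Sum>j<m. cnj (x $$ (i, j)) * y $$ (i, j))"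
    by (rule sum.swap)
  finally show ?thesis
    by (simp add: sum.cartesian_product)
qed

text \<open>The encoding by \<open>L2_set\<close> over index pairs gives this norm the same
  Cauchy-Schwarz and monotonicity rules as the Euclidean norm of vectors.\<close>

definition hs_norm :: "complex mat \<Rightarrow> real" where
  "hs_norm x = L2_set (\<lambda>ij. cmod (x $$ ij)) ({..<dim_row x} \<times> {..<dim_col x})"

lemma hs_norm_nonneg [simp]: "0 \<le> hs_norm x"
  by (simp add: hs_norm_def)

lemma hs_norm_square:
  "(hs_norm x)\<^sup>2 = (\<Sum>ij\<in>{..<dim_row x} \<times> {..<dim_col x}. (cmod (x $$ ij))\<^sup>2)"
  by (simp add: hs_norm_def L2_set_def sum_nonneg)

lemma hs_inner_self: "hs_inner x x = complex_of_real ((hs_norm x)\<^sup>2)"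
proof -
  have "x \<in> carrier_mat (dim_row x) (dim_col x)" by auto
  note hs_inner_eq_sum[OF this this]
  also have "(\<Sum>(i, j)\<in>{..<dim_row x} \<times> {..<dim_col x}. cnj (x $$ (i, j)) * x $$ (i, j)) =
    (\<Sum>ij\<in>{..<dim_row x} \<times> {..<dim_col x}. complex_of_real ((cmod (x $$ ij))\<^sup>2))"
    by (intro sum.cong) (auto simp: complex_norm_square mult.commute simp del: of_real_power)
  finally show ?thesis by (simp add: hs_norm_square)
qed

lemma hs_inner_commute:
  assumes "x \<in> carrier_mat n m" "y \<in> carrier_mat n m"
  shows "hs_inner y x = cnj (hs_inner x y)"
  using assms by (simp add: hs_inner_eq_sum cnj_sum case_prod_unfold mult.commute)

lemma cmod_hs_inner_le:
  assumes "x \<in> carrier_mat n m" "y \<in> carrier_mat n m"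
  shows "cmod (hs_inner x y) \<le> hs_norm x * hs_norm y"
proof -
  let ?I = "{..<n} \<times> {..<m}"
  have "cmod (hs_inner x y) \<le> (\<Sum>ij\<in>?I. cmod (x $$ ij) * cmod (y $$ ij))"
    unfolding hs_inner_eq_sum[OF assms]
    by (rule order_trans[OF norm_sum]) (auto simp: norm_mult case_prod_unfold)
  also have "\<dots> \<le> L2_set (\<lambda>ij. cmod (x $$ ij)) ?I * L2_set (\<lambda>ij. cmod (y $$ ij)) ?I"
    using L2_set_mult_ineq[of "\<lambda>ij. cmod (x $$ ij)" "\<lambda>ij. cmod (y $$ ij)" ?I] by simp
  finally show ?thesis using assms by (simp add: hs_norm_def carrier_matD)
qed

lemma hs_norm_minus_square:
  assumes "x \<in> carrier_mat n m" "y \<in> carrier_mat n m"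
  shows "(hs_norm (x - y))\<^sup>2 = (hs_norm x)\<^sup>2 + (hs_norm y)\<^sup>2 - 2 * Re (hs_inner x y)"
proof -
  have *: "(cmod (a - b))\<^sup>2 = (cmod a)\<^sup>2 + (cmod b)\<^sup>2 - 2 * Re (cnj a * b)" for a b
    unfolding cmod_power2 by (simp add: power2_eq_square algebra_simps)
  have "(hs_norm (x - y))\<^sup>2 = (\<Sum>ij\<in>{..<n} \<times> {..<m}.
      (cmod (x $$ ij))\<^sup>2 + (cmod (y $$ ij))\<^sup>2 - 2 * Re (cnj (x $$ ij) * y $$ ij))"
    unfolding *[symmetric] hs_norm_square using assms by (intro sum.cong) auto
  then show ?thesis
    using assms by (simp add: hs_norm_square hs_inner_eq_sum[OF assms] sum.distrib sum_subtractf
        sum_distrib_left Re_sum case_prod_unfold del: times_complex.sel)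
qed

lemma hs_norm_eq_0_iff:
  assumes "x \<in> carrier_mat n m"
  shows "hs_norm x = 0 \<longleftrightarrow> x = 0\<^sub>m n m"
  using assms by (auto simp: hs_norm_def L2_set_eq_0_iff mat_eq_iff)

lemma hs_norm_smult: "hs_norm (a \<cdot>\<^sub>m x) = cmod a * hs_norm x"
proof -
  have "hs_norm (a \<cdot>\<^sub>m x) = L2_set (\<lambda>ij. cmod a * cmod (x $$ ij)) ({..<dim_row x} \<times> {..<dim_col x})"
    unfolding hs_norm_def by (intro L2_set_cong) (auto simp: norm_mult)
  then show ?thesis by (simp add: hs_norm_def L2_set_right_distrib)
qed

lemma hs_inner_smult_right:
  assumes "x \<in> carrier_mat n m" "y \<in> carrier_mat n m"
  shows "hs_inner x (a \<cdot>\<^sub>m y) = a * hs_inner x y"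
proof -
  have "a \<cdot>\<^sub>m y \<in> carrier_mat n m" using assms(2) by simp
  then show ?thesis
    unfolding hs_inner_eq_sum[OF assms] hs_inner_eq_sum[OF assms(1) \<open>a \<cdot>\<^sub>m y \<in> carrier_mat n m\<close>] sum_distrib_left
    using assms(2) by (intro sum.cong) auto
qed

lemma hs_inner_one:
  assumes "x \<in> carrier_mat d d"
  shows "hs_inner (1\<^sub>m d) x = mat_trace x"
proof -
  have "mat_adjoint (1\<^sub>m d) = (1\<^sub>m d :: complex mat)" by (auto simp: mat_eq_iff)
  then show ?thesis using assms by (simp add: hs_inner_def)
qed

lemma mat_trace_minus:
  assumes "x \<in> carrier_mat d d" "y \<in> carrier_mat d d"
  shows "mat_trace (x - y) = mat_trace x - mat_trace y"
  using assms by (simp add: mat_trace_def sum_subtractf)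

lemma mat_trace_smult:
  "dim_row x = dim_col x \<Longrightarrow> mat_trace (a \<cdot>\<^sub>m x) = a * mat_trace x"
  by (simp add: mat_trace_def sum_distrib_left)

lemma mat_trace_one [simp]: "mat_trace (1\<^sub>m d) = of_nat d"
  by (simp add: mat_trace_def)

lemma self_adjoint_minus:
  "x \<in> carrier_mat d d \<Longrightarrow> y \<in> carrier_mat d d \<Longrightarrow> self_adjoint x \<Longrightarrow> self_adjoint y \<Longrightarrow> self_adjoint (x - y)"
  unfolding self_adjoint_iff[of x d] self_adjoint_iff[of y d] self_adjoint_iff[of "x - y" d, OF minus_carrier_mat]
  by (metis carrier_matD(1,2) complex_cnj_diff index_minus_mat(1))

lemma self_adjoint_smult_of_real:
  "x \<in> carrier_mat d d \<Longrightarrow> self_adjoint x \<Longrightarrow> self_adjoint (complex_of_real r \<cdot>\<^sub>m x)"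
  unfolding self_adjoint_iff[of x d] self_adjoint_iff[of "complex_of_real r \<cdot>\<^sub>m x" d, OF smult_carrier_mat]
  by (metis carrier_matD(1,2) complex_cnj_mult complex_cnj_complex_of_real index_smult_mat(1))

section \<open>The commutator semi-norm\<close>

lemma vec_l2_eq_L2_set: "vec_l2 v = L2_set (\<lambda>i. cmod (v $ i)) {..<dim_vec v}"
proof -
  have "v \<bullet>c v = (\<Sum>i<dim_vec v. complex_of_real ((cmod (v $ i))\<^sup>2))"
    by (simp add: scalar_prod_def atLeast0LessThan complex_norm_square del: of_real_power)
  then show ?thesis unfolding vec_l2_def L2_set_def by simp
qed

lemma vec_l2_nonneg [simp]: "0 \<le> vec_l2 v"
  by (simp add: vec_l2_eq_L2_set)

lemma vec_l2_smult: "vec_l2 (a \<cdot>\<^sub>v v) = cmod a * vec_l2 v"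
  by (simp add: vec_l2_eq_L2_set norm_mult L2_set_right_distrib cong: L2_set_cong_simp)

lemma vec_l2_unit_vec: "j < n \<Longrightarrow> vec_l2 (unit_vec n j) = 1"
  by (simp add: vec_l2_def)

text \<open>Cauchy-Schwarz in each row. This crude bound serves to show that the supremum in
  \<open>op_norm\<close> is taken over a bounded set.\<close>

lemma vec_l2_mult_mat_vec_le:
  assumes x: "x \<in> carrier_mat n m" and v: "v \<in> carrier_vec m"
  shows "vec_l2 (x *\<^sub>v v) \<le> hs_norm x * vec_l2 v"
proof -
  have le: "cmod ((x *\<^sub>v v) $ i) \<le> L2_set (\<lambda>j. cmod (x $$ (i, j))) {..<m} * vec_l2 v"
    if "i < n" for i
  proof -
    have "cmod ((x *\<^sub>v v) $ i) \<le> (\<Sum>j<m. cmod (x $$ (i, j)) * cmod (v $ j))"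
      using that x v
      by (auto simp: scalar_prod_def atLeast0LessThan norm_mult intro!: order_trans[OF norm_sum])
    also have "\<dots> \<le> L2_set (\<lambda>j. cmod (x $$ (i, j))) {..<m} * L2_set (\<lambda>j. cmod (v $ j)) {..<m}"
      using L2_set_mult_ineq[of "\<lambda>j. cmod (x $$ (i, j))" "\<lambda>j. cmod (v $ j)" "{..<m}"] by simp
    finally show ?thesis using v by (simp add: vec_l2_eq_L2_set)
  qed
  have "vec_l2 (x *\<^sub>v v) \<le>
      L2_set (\<lambda>i. L2_set (\<lambda>j. cmod (x $$ (i, j))) {..<m} * vec_l2 v) {..<n}"
    using x le by (auto simp: vec_l2_eq_L2_set[of "x *\<^sub>v v"] simp del: index_mult_mat_vec intro!: L2_set_mono)
  also have "\<dots> = L2_set (\<lambda>i. L2_set (\<lambda>j. cmod (x $$ (i, j))) {..<m}) {..<n} * vec_l2 v"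
    by (simp add: L2_set_left_distrib)
  also have "L2_set (\<lambda>i. L2_set (\<lambda>j. cmod (x $$ (i, j))) {..<m}) {..<n} = hs_norm x"
    using x by (simp add: hs_norm_def L2_set_def sum_nonneg sum.cartesian_product)
  finally show ?thesis .
qed

lemma vec_l2_le_op_norm:
  assumes x: "x \<in> carrier_mat n m" and v: "v \<in> carrier_vec m" "vec_l2 v \<le> 1"
  shows "vec_l2 (x *\<^sub>v v) \<le> op_norm x"
  unfolding op_norm_def
proof (rule cSup_upper)
  show "bdd_above {vec_l2 (x *\<^sub>v v) | v. v \<in> carrier_vec (dim_col x) \<and> vec_l2 v \<le> 1}"
  proof (rule bdd_aboveI[of _ "hs_norm x"])
    fix t assume "t \<in> {vec_l2 (x *\<^sub>v v) | v. v \<in> carrier_vec (dim_col x) \<and> vec_l2 v \<le> 1}"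
    then obtain w where w: "w \<in> carrier_vec m" "vec_l2 w \<le> 1" "t = vec_l2 (x *\<^sub>v w)"
      using x by auto
    have "hs_norm x * vec_l2 w \<le> hs_norm x" using w(2) by (simp add: mult_left_le)
    then show "t \<le> hs_norm x" using vec_l2_mult_mat_vec_le[OF x w(1)] w(3) by simp
  qed
qed (use x v in auto)

text \<open>An entry is a coordinate of the image of a basis vector. This lets the vanishing and the
  convergence of commutators be read off entry by entry.\<close>

lemma cmod_index_le_op_norm:
  assumes x: "x \<in> carrier_mat n m" and ij: "i < n" "j < m"
  shows "cmod (x $$ (i, j)) \<le> op_norm x"
proof -
  have "cmod (x $$ (i, j)) = cmod ((x *\<^sub>v unit_vec m j) $ i)"
    using x ij by simp
  also have "\<dots> \<le> vec_l2 (x *\<^sub>v unit_vec m j)"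
    unfolding vec_l2_eq_L2_set using x ij
    by (intro member_le_L2_set) auto
  also have "\<dots> \<le> op_norm x"
    using vec_l2_le_op_norm[OF x, of "unit_vec m j"] ij by (simp add: vec_l2_unit_vec)
  finally show ?thesis .
qed

lemma op_norm_least:
  assumes x: "x \<in> carrier_mat n m"
    and le: "\<And>v. v \<in> carrier_vec m \<Longrightarrow> vec_l2 v \<le> 1 \<Longrightarrow> vec_l2 (x *\<^sub>v v) \<le> b"
  shows "op_norm x \<le> b"
  unfolding op_norm_def
proof (rule cSup_least)
  have "vec_l2 (0\<^sub>v m) \<le> 1" by (simp add: vec_l2_eq_L2_set L2_set_def)
  then show "{vec_l2 (x *\<^sub>v v) | v. v \<in> carrier_vec (dim_col x) \<and> vec_l2 v \<le> 1} \<noteq> {}"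
    using x by (auto intro!: exI[of _ "0\<^sub>v m"])
qed (use x le in auto)

lemma op_norm_smult_le:
  assumes x: "x \<in> carrier_mat n m"
  shows "op_norm (a \<cdot>\<^sub>m x) \<le> cmod a * op_norm x"
proof (rule op_norm_least)
  fix v :: "complex vec" assume v: "v \<in> carrier_vec m" "vec_l2 v \<le> 1"
  have "(a \<cdot>\<^sub>m x) *\<^sub>v v = a \<cdot>\<^sub>v (x *\<^sub>v v)"
    using x v by (auto simp: scalar_prod_def sum_distrib_left mult.assoc)
  then show "vec_l2 ((a \<cdot>\<^sub>m x) *\<^sub>v v) \<le> cmod a * op_norm x"
    using vec_l2_le_op_norm[OF x v] by (simp add: vec_l2_smult mult_left_mono)
qed (use x in auto)

section \<open>The semi-norm of a finite resource set and its Lipschitz constants\<close>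

context
  fixes d :: nat and S :: "complex mat set"
  assumes finite_S: "finite S" and S_carrier: "S \<subseteq> carrier_mat d d"
begin

lemma op_norm_commutator_le:
  "s \<in> S \<Longrightarrow> op_norm (s * x - x * s) \<le> comm_seminorm S x"
  unfolding comm_seminorm_def using finite_S by (intro cSup_upper) auto

lemma comm_seminorm_nonneg: "0 \<le> comm_seminorm S x"
  unfolding comm_seminorm_def using finite_S by (intro cSup_upper) auto

lemma comm_seminorm_least:
  "0 \<le> b \<Longrightarrow> (\<And>s. s \<in> S \<Longrightarrow> op_norm (s * x - x * s) \<le> b) \<Longrightarrow> comm_seminorm S x \<le> b"
  unfolding comm_seminorm_def by (intro cSup_least) auto

lemma comm_seminorm_smult_le:
  assumes x: "x \<in> carrier_mat d d"
  shows "comm_seminorm S (a \<cdot>\<^sub>m x) \<le> cmod a * comm_seminorm S x"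
proof (rule comm_seminorm_least)
  fix s assume s: "s \<in> S"
  then have s': "s \<in> carrier_mat d d" using S_carrier by auto
  have "s * (a \<cdot>\<^sub>m x) - (a \<cdot>\<^sub>m x) * s = a \<cdot>\<^sub>m (s * x - x * s)"
    using s' x by (auto simp: mult_smult_distrib mult_smult_assoc_mat right_diff_distrib)
  then have "op_norm (s * (a \<cdot>\<^sub>m x) - (a \<cdot>\<^sub>m x) * s) \<le> cmod a * op_norm (s * x - x * s)"
    using s' x by (simp add: op_norm_smult_le[OF minus_carrier_mat[OF mult_carrier_mat]])
  also have "\<dots> \<le> cmod a * comm_seminorm S x"
    by (simp add: mult_left_mono op_norm_commutator_le[OF s])
  finally show "op_norm (s * (a \<cdot>\<^sub>m x) - (a \<cdot>\<^sub>m x) * s) \<le> cmod a * comm_seminorm S x" .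
qed (simp add: comm_seminorm_nonneg)

lemma cmod_commutator_le:
  assumes "s \<in> S" "x \<in> carrier_mat d d" "i < d" "j < d"
  shows "cmod ((s * x - x * s) $$ (i, j)) \<le> comm_seminorm S x"
  using cmod_index_le_op_norm[of "s * x - x * s" d d i j] op_norm_commutator_le[of s x] assms
    S_carrier by fastforce

lemma comm_seminorm_eq_0_iff:
  assumes x: "x \<in> carrier_mat d d"
  shows "comm_seminorm S x = 0 \<longleftrightarrow> x \<in> commutant d S"
proof
  assume 0: "comm_seminorm S x = 0"
  have "s * x = x * s" if s: "s \<in> S" for s
  proof (rule eq_matI)
    have s': "s \<in> carrier_mat d d" using s S_carrier by auto
    fix i j assume "i < dim_row (x * s)" "j < dim_col (x * s)"
    then have ij: "i < d" "j < d" using s' x by auto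
    have "(s * x - x * s) $$ (i, j) = 0"
      using cmod_commutator_le[OF s x ij] 0 by simp
    then show "(s * x) $$ (i, j) = (x * s) $$ (i, j)"
      using s' x ij by simp
  qed (use s S_carrier x in auto)
  then show "x \<in> commutant d S" using x by (auto simp: commutant_def)
next
  assume c: "x \<in> commutant d S"
  have "comm_seminorm S x \<le> 0"
  proof (rule comm_seminorm_least)
    fix s assume s: "s \<in> S"
    \<comment> \<open>The zero commutator is written as a zero multiple of itself, so that
      homogeneity bounds its operator norm by 0.\<close>
    then have "s * x - x * s = 0 \<cdot>\<^sub>m (s * x - x * s)"
      using c by (auto simp: commutant_def)
    moreover have "op_norm (0 \<cdot>\<^sub>m (s * x - x * s)) \<le> 0"
      using op_norm_smult_le[OF carrier_matI[OF refl refl], of 0 "s * x - x * s"] by simp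
    ultimately show "op_norm (s * x - x * s) \<le> 0" by simp
  qed simp
  then show "comm_seminorm S x = 0" using comm_seminorm_nonneg[of x] by simp
qed

text \<open>The zero matrix is admissible, so the supremum is not that of the empty set, which is
  -\<infinity> in \<open>ereal\<close>. Together with the upper bounds in the theorem this makes
  both Lipschitz constants real numbers.\<close>

lemma Lip_nonneg:
  assumes "linear_on_mats d \<Psi>"
  shows "0 \<le> Lip d S \<Psi>"
proof -
  have "0\<^sub>m d d \<in> carrier_mat d d \<and> self_adjoint (0\<^sub>m d d) \<and> comm_seminorm S (0\<^sub>m d d) \<le> 1"
    using S_carrier comm_seminorm_eq_0_iff[of "0\<^sub>m d d"]
    by (auto simp: self_adjoint_iff[of _ d] commutant_def)
  then have "ereal (comm_seminorm S (\<Psi> (0\<^sub>m d d))) \<le> Lip d S \<Psi>"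
    unfolding Lip_def by (intro Sup_upper) blast
  then show ?thesis using comm_seminorm_nonneg[of "\<Psi> (0\<^sub>m d d)"] 
    by (metis ereal_less_eq(5) order_trans)
qed

text \<open>Normalise x, apply the definition of \<open>Lip\<close>, and scale back. A matrix of
  semi-norm 0 cannot be normalised; that case is settled later, where elements of the commutant are
  fixed points.\<close>

lemma comm_seminorm_map_le:
  assumes \<Psi>: "linear_on_mats d \<Psi>" and L: "Lip d S \<Psi> \<le> ereal L"
    and x: "x \<in> carrier_mat d d" "self_adjoint x" and pos: "0 < comm_seminorm S x"
  shows "comm_seminorm S (\<Psi> x) \<le> L * comm_seminorm S x"
proof -
  let ?N = "comm_seminorm S x"
  define u where "u = complex_of_real (1 / ?N) \<cdot>\<^sub>m x"
  have u: "u \<in> carrier_mat d d" "self_adjoint u"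
    using x unfolding u_def by (auto intro!: self_adjoint_smult_of_real simp del: of_real_divide)
  have "comm_seminorm S u \<le> 1"
    using comm_seminorm_smult_le[OF x(1), of "complex_of_real (1 / ?N)"] pos
    by (simp add: u_def norm_divide)
  then have "ereal (comm_seminorm S (\<Psi> u)) \<le> Lip d S \<Psi>"
    unfolding Lip_def using u by (intro Sup_upper) blast
  then have le: "comm_seminorm S (\<Psi> u) \<le> L" using L by (metis ereal_less_eq(3) order_trans)
  have "x = complex_of_real ?N \<cdot>\<^sub>m u" using pos x by (auto simp: u_def)
  then have "\<Psi> x = complex_of_real ?N \<cdot>\<^sub>m \<Psi> u"
    using \<Psi> u unfolding linear_on_mats_def by metis
  then have "comm_seminorm S (\<Psi> x) \<le> ?N * comm_seminorm S (\<Psi> u)"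
    using comm_seminorm_smult_le[of "\<Psi> u" "complex_of_real ?N"] pos u \<Psi>
    by (simp add: linear_on_mats_def)
  also have "\<dots> \<le> ?N * L" using le pos by simp
  finally show ?thesis by (simp add: mult.commute)
qed

end

section \<open>Positive semidefinite matrices\<close>

lemma quadratic_form_eq_sum:
  assumes x: "x \<in> carrier_mat d d" and v: "v \<in> carrier_vec d"
  shows "(x *\<^sub>v v) \<bullet>c v = (\<Sum>k<d. \<Sum>l<d. cnj (v $ k) * x $$ (k, l) * v $ l)"
proof -
  have "(x *\<^sub>v v) \<bullet>c v = (\<Sum>k<d. (\<Sum>l<d. x $$ (k, l) * v $ l) * cnj (v $ k))"
    using x v by (simp add: scalar_prod_def atLeast0LessThan)
  then show ?thesis by (simp add: sum_distrib_left sum_distrib_right mult_ac)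
qed

text \<open>Test vectors become plain functions on indices, whose values from \<open>d\<close> on
  never enter; this keeps the explicit vectors used below short.\<close>

lemma psd_iff:
  assumes x: "x \<in> carrier_mat d d"
  shows "psd d x \<longleftrightarrow> (\<forall>v. 0 \<le> (\<Sum>k<d. \<Sum>l<d. cnj (v k) * x $$ (k, l) * v l))"
proof
  assume psd: "psd d x"
  show "\<forall>v. 0 \<le> (\<Sum>k<d. \<Sum>l<d. cnj (v k) * x $$ (k, l) * v l)"
  proof
    fix v :: "nat \<Rightarrow> complex"
    have "0 \<le> (x *\<^sub>v vec d v) \<bullet>c vec d v" using psd by (simp add: psd_def)
    then show "0 \<le> (\<Sum>k<d. \<Sum>l<d. cnj (v k) * x $$ (k, l) * v l)"
      using x by (simp add: quadratic_form_eq_sum)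
  qed
next
  assume "\<forall>v. 0 \<le> (\<Sum>k<d. \<Sum>l<d. cnj (v k) * x $$ (k, l) * v l)"
  then show "psd d x" using x by (simp add: psd_def quadratic_form_eq_sum[OF x])
qed

lemma psd_two_entries:
  assumes psd: "psd d x" and ij: "i < d" "j < d"
  shows "0 \<le> cnj a * x $$ (i, i) * a + cnj b * x $$ (j, j) * b
    + cnj a * x $$ (i, j) * b + cnj b * x $$ (j, i) * a"
proof -
  have x: "x \<in> carrier_mat d d" using psd by (simp add: psd_def)
  \<comment> \<open>The vector a e_i + b e_j. Adding two indicators, instead of nesting
    conditionals, also covers i = j.\<close>
  define v where "v k = (if k = i then a else 0) + (if k = j then b else 0)" for k
  have row: "(\<Sum>l<d. x $$ (k, l) * v l) = x $$ (k, i) * a + x $$ (k, j) * b" for k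
    using ij by (simp add: v_def distrib_left sum.distrib if_distrib[of "\<lambda>t. _ * t"] cong: if_cong)
  have col: "(\<Sum>k<d. cnj (v k) * w k) = cnj a * w i + cnj b * w j" for w
    using ij by (simp add: v_def distrib_right sum.distrib if_distrib[of cnj]
        if_distrib[of "\<lambda>t. t * _"] cong: if_cong)
  have "(\<Sum>k<d. \<Sum>l<d. cnj (v k) * x $$ (k, l) * v l) =
      (\<Sum>k<d. cnj (v k) * (\<Sum>l<d. x $$ (k, l) * v l))"
    by (simp add: sum_distrib_left mult.assoc)
  also have "\<dots> = cnj a * (x $$ (i, i) * a + x $$ (i, j) * b) + cnj b * (x $$ (j, i) * a + x $$ (j, j) * b)"
    unfolding row col ..
  finally show ?thesis using psd[unfolded psd_iff[OF x], rule_format, of v]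
    by (simp add: algebra_simps)
qed

lemma psd_diag_nonneg:
  assumes "psd d x" "i < d"
  shows "0 \<le> x $$ (i, i)"
  using psd_two_entries[OF assms(1,2,2), of 1 0] by simp

text \<open>Polarisation: the form is real at e_i + e_j, which relates the imaginary parts of the
  two opposite entries, and at e_i + \<i> e_j, which relates their real parts.\<close>

lemma psd_self_adjoint:
  assumes psd: "psd d x"
  shows "self_adjoint x"
proof -
  have x: "x \<in> carrier_mat d d" using psd by (simp add: psd_def)
  have "cnj (x $$ (j, i)) = x $$ (i, j)" if ij: "i < d" "j < d" for i j
    using psd_two_entries[OF psd ij, of 1 1] psd_two_entries[OF psd ij, of 1 \<i>]
      psd_diag_nonneg[OF psd ij(1)] psd_diag_nonneg[OF psd ij(2)]
    by (auto simp: less_eq_complex_def complex_eq_iff)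
  then show ?thesis by (simp add: self_adjoint_iff[OF x])
qed

text \<open>The form is evaluated at e_i + b e_j with a phase b that turns the off-diagonal
  contribution into -2 |x_ij|. The arithmetic mean of the diagonal entries is preferred to the
  geometric one because it can be summed directly over i and j.\<close>

lemma psd_cmod_entry_le:
  assumes psd: "psd d x" and ij: "i < d" "j < d"
  shows "cmod (x $$ (i, j)) \<le> (Re (x $$ (i, i)) + Re (x $$ (j, j))) / 2"
proof (cases "x $$ (i, j) = 0")
  case True
  then show ?thesis using psd_diag_nonneg[OF psd ij(1)] psd_diag_nonneg[OF psd ij(2)]
    by (auto simp: less_eq_complex_def)
next
  case False
  define z where "z = x $$ (i, j)"
  \<comment> \<open>The unimodular number with z b = -|z|.\<close>
  define b where "b = - cnj z / of_real (cmod z)"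
  have x: "x \<in> carrier_mat d d" using psd by (simp add: psd_def)
  have z0: "cmod z \<noteq> 0" using False by (simp add: z_def)
  have zz: "z * cnj z = of_real (cmod z) * of_real (cmod z)"
    using complex_norm_square[of z] by (simp add: power2_eq_square)
  have zb: "z * b = - of_real (cmod z)" using z0 zz by (simp add: b_def field_simps)
  have bb: "cnj b * b = 1" using z0 zz by (simp add: b_def field_simps)
  have "x $$ (j, i) = cnj z"
    using psd_self_adjoint[OF psd] ij by (simp add: self_adjoint_iff[OF x] z_def)
  then have "0 \<le> x $$ (i, i) + (cnj b * b) * x $$ (j, j) + z * b + cnj (z * b)"
    using psd_two_entries[OF psd ij, of 1 b] by (simp add: z_def algebra_simps)
  then show ?thesis unfolding zb bb by (simp add: less_eq_complex_def z_def)
qed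

text \<open>All entries have modulus at most 1, so their squares are bounded by their moduli, and
  these by averages of diagonal entries that sum to d. The sharp bound is 1; the loss ends up inside
  a logarithm.\<close>

lemma hs_norm_density_matrix_le:
  assumes "density_matrix d \<rho>"
  shows "(hs_norm \<rho>)\<^sup>2 \<le> real d"
proof -
  have psd: "psd d \<rho>" and tr: "mat_trace \<rho> = 1" using assms by (auto simp: density_matrix_def)
  have \<rho>: "\<rho> \<in> carrier_mat d d" using psd by (simp add: psd_def)
  let ?r = "\<lambda>i. Re (\<rho> $$ (i, i))"
  have sum: "(\<Sum>i<d. ?r i) = 1" using tr \<rho> by (simp add: mat_trace_def Re_sum[symmetric])
  have nonneg: "0 \<le> ?r i" if "i < d" for i
    using psd_diag_nonneg[OF psd that] by (simp add: less_eq_complex_def)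
  have le1: "?r i \<le> 1" if "i < d" for i
    unfolding sum[symmetric] using that nonneg by (intro member_le_sum) auto
  have "(hs_norm \<rho>)\<^sup>2 = (\<Sum>i<d. \<Sum>j<d. (cmod (\<rho> $$ (i, j)))\<^sup>2)"
    using \<rho> by (simp add: hs_norm_square sum.cartesian_product)
  also have "\<dots> \<le> (\<Sum>i<d. \<Sum>j<d. (?r i + ?r j) / 2)"
  proof (intro sum_mono)
    fix i j assume "i \<in> {..<d}" "j \<in> {..<d}"
    then have ij: "i < d" "j < d" by auto
    note le = psd_cmod_entry_le[OF psd ij]
    have "cmod (\<rho> $$ (i, j)) \<le> 1" using le le1[OF ij(1)] le1[OF ij(2)] by simp
    then have "(cmod (\<rho> $$ (i, j)))\<^sup>2 \<le> cmod (\<rho> $$ (i, j))"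
      by (simp add: power2_eq_square mult_left_le)
    then show "(cmod (\<rho> $$ (i, j)))\<^sup>2 \<le> (?r i + ?r j) / 2" using le by simp
  qed
  also have "\<dots> = real d"
    by (simp add: sum.distrib sum_divide_distrib[symmetric] sum_distrib_left[symmetric] sum)
  finally show ?thesis .
qed

text \<open>The form at v is the squared length of the adjoint of V applied to v.\<close>

lemma psd_mult_adjoint:
  assumes V: "V \<in> carrier_mat n m"
  shows "psd n (V * mat_adjoint V)"
proof -
  have VV: "V * mat_adjoint V \<in> carrier_mat n n" using V by (intro mult_carrier_mat) auto
  show ?thesis unfolding psd_iff[OF VV]
  proof
    fix v :: "nat \<Rightarrow> complex"
    let ?s = "\<lambda>p. \<Sum>l<n. cnj (V $$ (l, p)) * v l"
    have "(\<Sum>k<n. \<Sum>l<n. cnj (v k) * (V * mat_adjoint V) $$ (k, l) * v l) =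
        (\<Sum>k<n. \<Sum>l<n. \<Sum>p<m. cnj (v k) * V $$ (k, p) * (cnj (V $$ (l, p)) * v l))"
      using V by (simp add: scalar_prod_def atLeast0LessThan sum_distrib_left sum_distrib_right mult_ac)
    also have "\<dots> = (\<Sum>k<n. \<Sum>p<m. \<Sum>l<n. cnj (v k) * V $$ (k, p) * (cnj (V $$ (l, p)) * v l))"
      by (rule sum.cong[OF refl], rule sum.swap)
    also have "\<dots> = (\<Sum>p<m. \<Sum>k<n. \<Sum>l<n. cnj (v k) * V $$ (k, p) * (cnj (V $$ (l, p)) * v l))"
      by (rule sum.swap)
    also have "\<dots> = (\<Sum>p<m. cnj (?s p) * ?s p)"
      unfolding cnj_sum sum_product by (simp add: mult_ac)
    also have "0 \<le> \<dots>"
    proof (rule sum_nonneg)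
      show "0 \<le> cnj z * z" for z by (simp add: less_eq_complex_def)
    qed
    finally show "0 \<le> (\<Sum>k<n. \<Sum>l<n. cnj (v k) * (V * mat_adjoint V) $$ (k, l) * v l)" .
  qed
qed

text \<open>The form of y at v is the pairing of y with the rank one matrix of v, so Cauchy-Schwarz
  bounds it by \<open>hs_norm y\<close> times the squared length of v. No spectral theory is
  involved.\<close>

lemma psd_add_scalar:
  assumes y: "y \<in> carrier_mat d d" "self_adjoint y" and c: "hs_norm y \<le> c"
  shows "psd d (y + complex_of_real c \<cdot>\<^sub>m 1\<^sub>m d)"
proof -
  have yc: "y + complex_of_real c \<cdot>\<^sub>m 1\<^sub>m d \<in> carrier_mat d d" using y by auto
  show ?thesis unfolding psd_iff[OF yc]
  proof
    fix v :: "nat \<Rightarrow> complex"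
    \<comment> \<open>The rank one matrix of v; its Hilbert-Schmidt norm is exactly the squared
      length \<open>?n\<close>.\<close>
    define P where "P = mat d d (\<lambda>(k, l). v k * cnj (v l))"
    have P: "P \<in> carrier_mat d d" by (simp add: P_def)
    let ?n = "\<Sum>k<d. (cmod (v k))\<^sup>2"
    have form: "(\<Sum>k<d. \<Sum>l<d. cnj (v k) * y $$ (k, l) * v l) = hs_inner P y"
      unfolding hs_inner_eq_sum[OF P y(1)] sum.cartesian_product[symmetric]
      by (intro sum.cong refl) (simp add: P_def)
    have "(hs_norm P)\<^sup>2 = ?n\<^sup>2"
      unfolding hs_norm_square power2_eq_square[of ?n] sum_product sum.cartesian_product
      by (intro sum.cong) (auto simp: P_def norm_mult power_mult_distrib)
    then have nP: "hs_norm P = ?n" by (simp add: sum_nonneg)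
    have "cmod (hs_inner P y) \<le> ?n * hs_norm y"
      using cmod_hs_inner_le[OF P y(1)] nP by simp
    also have "\<dots> \<le> ?n * c" using c by (intro mult_left_mono) (auto intro: sum_nonneg)
    finally have "cmod (hs_inner P y) \<le> ?n * c" .
    then have Re: "0 \<le> Re (hs_inner P y) + ?n * c"
      using abs_Re_le_cmod[of "hs_inner P y"] by linarith
    \<comment> \<open>The order on the complex numbers demands a real value; self-adjointness of y
      provides it.\<close>
    have "cnj (hs_inner P y) = (\<Sum>k<d. \<Sum>l<d. v k * y $$ (l, k) * cnj (v l))"
      unfolding form[symmetric] using y(2)[unfolded self_adjoint_iff[OF y(1)]] by (simp add: cnj_sum)
    also have "\<dots> = hs_inner P y"
      unfolding form[symmetric] by (subst sum.swap) (simp add: mult_ac)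
    finally have Im: "Im (hs_inner P y) = 0" by (simp add: complex_eq_iff)
    have "(\<Sum>k<d. \<Sum>l<d. cnj (v k) * (y + complex_of_real c \<cdot>\<^sub>m 1\<^sub>m d) $$ (k, l) * v l) =
       (\<Sum>k<d. \<Sum>l<d. cnj (v k) * y $$ (k, l) * v l + (if k = l then cnj (v k) * c * v k else 0))"
      using y by (intro sum.cong refl) (auto simp: algebra_simps)
    also have "\<dots> = hs_inner P y + (\<Sum>k<d. cnj (v k) * c * v k)"
      by (simp add: sum.distrib form)
    also have "(\<Sum>k<d. cnj (v k) * c * v k) = complex_of_real (?n * c)"
      by (simp add: sum_distrib_left sum_distrib_right complex_norm_square mult_ac del: of_real_power)
    finally show "0 \<le> (\<Sum>k<d. \<Sum>l<d. cnj (v k) * (y + complex_of_real c \<cdot>\<^sub>m 1\<^sub>m d) $$ (k, l) * v l)"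
      using Re Im by (simp add: less_eq_complex_def)
  qed
qed

section \<open>Unital channels contract the Hilbert--Schmidt norm\<close>

lemma sum_lessThan_double:
  "(\<Sum>i<2 * d. f i) = (\<Sum>i<d. f i) + (\<Sum>i<d. f (d + i))" for f :: "nat \<Rightarrow> 'a :: comm_monoid_add"
proof -
  have "(\<Sum>i<d + n. f i) = (\<Sum>i<d. f i) + (\<Sum>i<n. f (d + i))" for n
    by (induction n) (simp_all add: add.assoc)
  then show ?thesis by (simp add: mult_2)
qed

text \<open>Complete positivity is applied to the block matrix with rows \<open>(1, x)\<close> and
  \<open>(x\<^sup>*, x\<^sup>* x)\<close>, which is \<open>V V\<^sup>*\<close> for \<open>V\<^sup>* = (1, x)\<close>.\<close>

lemma completely_positive_block:
  assumes cp: "completely_positive d \<Phi>" and un: "unital d \<Phi>" and x: "x \<in> carrier_mat d d"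
  shows "psd (2 * d)
    (four_block_mat (1\<^sub>m d) (\<Phi> x) (\<Phi> (mat_adjoint x)) (\<Phi> (mat_adjoint x * x)))" (is "psd _ ?B")
proof -
  define V where "V = mat (2 * d) d (\<lambda>(i, k). if i < d then 1\<^sub>m d $$ (i, k) else cnj (x $$ (k, i - d)))"
  define X where "X = V * mat_adjoint V"
  have V: "V \<in> carrier_mat (2 * d) d" by (simp add: V_def)
  have X: "X \<in> carrier_mat (2 * d) (2 * d)" using V unfolding X_def by (intro mult_carrier_mat) auto
  have X_entry: "X $$ (i, j) = (\<Sum>k<d. V $$ (i, k) * cnj (V $$ (j, k)))" if "i < 2 * d" "j < 2 * d" for i j
    using that V by (simp add: X_def scalar_prod_def atLeast0LessThan)
  have delta: "(\<Sum>k<d. (if i = k then 1 else 0) * f k) = f i"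
    "(\<Sum>k<d. f k * (if i = k then 1 else 0)) = f i" if "i < d" for i and f :: "nat \<Rightarrow> complex"
    using that by (simp_all add: if_distrib[of "\<lambda>t. t * _"] if_distrib[of "\<lambda>t. _ * t"] cong: if_cong)
  have b00: "mat_block d 0 0 X = 1\<^sub>m d"
    by (rule eq_matI) (auto simp: mat_block_def X_entry V_def delta if_distrib[of cnj] cong: if_cong)
  have b01: "mat_block d 0 1 X = x"
    using x by (intro eq_matI) (auto simp: mat_block_def X_entry V_def delta)
  have b10: "mat_block d 1 0 X = mat_adjoint x"
    using x by (intro eq_matI)
      (auto simp: mat_block_def X_entry V_def delta if_distrib[of cnj] cong: if_cong)
  have b11: "mat_block d 1 1 X = mat_adjoint x * x"
    using x by (intro eq_matI)
      (auto simp: mat_block_def X_entry V_def scalar_prod_def atLeast0LessThan)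
  let ?Y = "amplification 2 d \<Phi> X"
  have "psd (2 * d) ?Y"
    using cp psd_mult_adjoint[OF V] unfolding completely_positive_def X_def by blast
  moreover have "?Y = ?B"
  proof (rule eq_matI)
    have car: "\<Phi> x \<in> carrier_mat d d" "\<Phi> (mat_adjoint x) \<in> carrier_mat d d"
      "\<Phi> (mat_adjoint x * x) \<in> carrier_mat d d"
      using cp x mult_carrier_mat[OF mat_adjoint_carrier[OF x] x]
      by (auto simp: completely_positive_def linear_on_mats_def)
    then show "dim_row ?Y = dim_row ?B" "dim_col ?Y = dim_col ?B"
      by (auto simp: amplification_def)
    fix i j assume "i < dim_row ?B" "j < dim_col ?B"
    then have ij: "i < 2 * d" "j < 2 * d" using car by auto
    have d: "k div d = 1" "k mod d = k - d" if "\<not> k < d" "k < 2 * d" for k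
      using that by (auto simp: div_if mod_if)
    show "?Y $$ (i, j) = ?B $$ (i, j)"
      using ij car un d[of i] d[of j]
      by (cases "i < d"; cases "j < d")
        (auto simp: amplification_def b00 b01 b10 b11 unital_def simp del: One_nat_def)
  qed
  ultimately show ?thesis by simp
qed

text \<open>The image of the block matrix is positive, hence self-adjoint, and the two matrices
  compared here are its off-diagonal blocks.\<close>

lemma completely_positive_adjoint:
  assumes cp: "completely_positive d \<Phi>" and un: "unital d \<Phi>" and x: "x \<in> carrier_mat d d"
  shows "\<Phi> (mat_adjoint x) = mat_adjoint (\<Phi> x)"
proof -
  define Y where "Y = four_block_mat (1\<^sub>m d) (\<Phi> x) (\<Phi> (mat_adjoint x)) (\<Phi> (mat_adjoint x * x))"
  have psd: "psd (2 * d) Y"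
    unfolding Y_def by (rule completely_positive_block[OF cp un x])
  have "Y \<in> carrier_mat (2 * d) (2 * d)" using psd by (simp add: psd_def)
  from psd_self_adjoint[OF psd, unfolded self_adjoint_iff[OF this]]
  have herm: "cnj (Y $$ (j, i)) = Y $$ (i, j)" if "i < 2 * d" "j < 2 * d" for i j using that by blast
  have car: "\<Phi> x \<in> carrier_mat d d" "\<Phi> (mat_adjoint x) \<in> carrier_mat d d"
    "\<Phi> (mat_adjoint x * x) \<in> carrier_mat d d"
    using cp x mult_carrier_mat[OF mat_adjoint_carrier[OF x] x]
    by (auto simp: completely_positive_def linear_on_mats_def)
  have "\<Phi> (mat_adjoint x) $$ (i, j) = cnj (\<Phi> x $$ (j, i))" if "i < d" "j < d" for i j
    using herm[of "d + i" j] that car by (simp add: Y_def)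
  then show ?thesis using car by (intro eq_matI) auto
qed

text \<open>The Kadison-Schwarz inequality, that \<open>\<Phi>\<close> of
  \<open>mat_adjoint x * x\<close> dominates \<open>mat_adjoint (\<Phi> x) * \<Phi> x\<close>, read
  on the diagonal and summed. Trace preservation then returns the squared norm of x.\<close>

lemma hs_norm_channel_le:
  assumes cp: "completely_positive d \<Phi>" and un: "unital d \<Phi>" and tp: "trace_preserving d \<Phi>"
    and x: "x \<in> carrier_mat d d"
  shows "hs_norm (\<Phi> x) \<le> hs_norm x"
proof -
  define Y where "Y = four_block_mat (1\<^sub>m d) (\<Phi> x) (\<Phi> (mat_adjoint x)) (\<Phi> (mat_adjoint x * x))"
  have psd: "psd (2 * d) Y"
    unfolding Y_def by (rule completely_positive_block[OF cp un x])
  have YC: "Y \<in> carrier_mat (2 * d) (2 * d)" using psd by (simp add: psd_def)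
  have xx: "mat_adjoint x * x \<in> carrier_mat d d" using x by (intro mult_carrier_mat) auto
  have car: "\<Phi> x \<in> carrier_mat d d" "\<Phi> (mat_adjoint x * x) \<in> carrier_mat d d"
    "\<Phi> (mat_adjoint x) \<in> carrier_mat d d"
    using cp x xx by (auto simp: completely_positive_def linear_on_mats_def)
  have Y: "Y $$ (i, j) = 1\<^sub>m d $$ (i, j)" "Y $$ (i, d + j) = \<Phi> x $$ (i, j)"
    "Y $$ (d + i, j) = \<Phi> (mat_adjoint x) $$ (i, j)"
    "Y $$ (d + i, d + j) = \<Phi> (mat_adjoint x * x) $$ (i, j)" if "i < d" "j < d" for i j
    using that car by (simp_all add: Y_def)
  have col: "(\<Sum>i<d. (cmod (\<Phi> x $$ (i, j)))\<^sup>2) \<le> Re (\<Phi> (mat_adjoint x * x) $$ (j, j))"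
    if j: "j < d" for j
  proof -
    \<comment> \<open>The form of \<open>Y\<close> is evaluated at the block vector \<open>(- \<Phi>(x) e\<^sub>j, e\<^sub>j)\<close>.\<close>
    define w where "w i = (if i < d then - \<Phi> x $$ (i, j) else if i = d + j then 1 else 0)" for i
    define A where "A = (\<Sum>i<d. cnj (\<Phi> x $$ (i, j)) * \<Phi> x $$ (i, j))"
    have row: "(\<Sum>l<2 * d. Y $$ (k, l) * w l) = (\<Sum>l<d. - (Y $$ (k, l) * \<Phi> x $$ (l, j))) + Y $$ (k, d + j)"
      for k
      unfolding sum_lessThan_double using j
      by (simp add: w_def if_distrib[of "\<lambda>t. _ * t"] cong: if_cong)
    \<comment> \<open>A Schur complement: with the identity in the upper left block, the first d
      coordinates of Y w cancel, and only coordinate d + j contributes to the form.\<close>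
    have top: "(\<Sum>l<2 * d. Y $$ (k, l) * w l) = 0" if "k < d" for k
    proof -
      have "(\<Sum>l<d. Y $$ (k, l) * \<Phi> x $$ (l, j)) = (\<Sum>l<d. if l = k then \<Phi> x $$ (l, j) else 0)"
        using that by (intro sum.cong) (auto simp: Y)
      then show ?thesis unfolding row using that j by (simp add: sum_negf Y)
    qed
    have "(\<Sum>k<2 * d. \<Sum>l<2 * d. cnj (w k) * Y $$ (k, l) * w l) =
        (\<Sum>k<2 * d. cnj (w k) * (\<Sum>l<2 * d. Y $$ (k, l) * w l))"
      by (simp add: sum_distrib_left mult.assoc)
    also have "\<dots> = (\<Sum>l<2 * d. Y $$ (d + j, l) * w l)"
      unfolding sum_lessThan_double[of "\<lambda>k. cnj (w k) * _ k"] using j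
      by (simp add: top) (simp add: w_def if_distrib[of cnj] if_distrib[of "\<lambda>t. t * _"] cong: if_cong)
    also have "\<dots> = \<Phi> (mat_adjoint x * x) $$ (j, j) - A"
      unfolding row using j x car
      by (simp add: Y A_def completely_positive_adjoint[OF cp un x] sum_negf)
    finally have "0 \<le> \<Phi> (mat_adjoint x * x) $$ (j, j) - A"
      using psd[unfolded psd_iff[OF YC], rule_format, of w] by simp
    moreover have "A = complex_of_real (\<Sum>i<d. (cmod (\<Phi> x $$ (i, j)))\<^sup>2)"
      by (simp add: A_def complex_norm_square mult.commute del: of_real_power)
    ultimately show ?thesis by (simp add: less_eq_complex_def)
  qed
  have "(hs_norm (\<Phi> x))\<^sup>2 = (\<Sum>i<d. \<Sum>j<d. (cmod (\<Phi> x $$ (i, j)))\<^sup>2)"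
    using car by (simp add: hs_norm_square sum.cartesian_product)
  also have "\<dots> = (\<Sum>j<d. \<Sum>i<d. (cmod (\<Phi> x $$ (i, j)))\<^sup>2)"
    by (rule sum.swap)
  also have "\<dots> \<le> (\<Sum>j<d. Re (\<Phi> (mat_adjoint x * x) $$ (j, j)))"
    by (intro sum_mono col) auto
  also have "\<dots> = Re (mat_trace (\<Phi> (mat_adjoint x * x)))"
    using car by (simp add: mat_trace_def)
  also have "\<dots> = Re (hs_inner x x)"
    using tp xx by (simp add: trace_preserving_def hs_inner_def)
  also have "\<dots> = (hs_norm x)\<^sup>2"
    by (simp add: hs_inner_self del: of_real_power)
  finally show ?thesis by (simp add: power2_le_iff_abs_le)
qed

section \<open>The commutator semi-norm dominates the Hilbert--Schmidt norm\<close>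

text \<open>Since \<open>\<Phi>\<close> is unital, adding a multiple of the identity keeps y fixed.
  A large enough shift makes it positive, and after normalisation it is a fixed state, so uniqueness
  applies.\<close>

lemma fixed_self_adjoint_is_scalar:
  assumes lin: "linear_on_mats d \<Phi>" and un: "unital d \<Phi>" and d: "d \<ge> 1"
    and unique: "unique_fixed_state d \<Phi> (maximally_mixed d)"
    and y: "y \<in> carrier_mat d d" "self_adjoint y" and fixed: "\<Phi> y = y"
  obtains a where "y = a \<cdot>\<^sub>m 1\<^sub>m d"
proof -
  \<comment> \<open>Shifting by the norm alone makes z positive with trace at least 0; the extra 1
    adds d \<ge> 1 to the trace, so w can be normalised.\<close>
  define c where "c = hs_norm y + 1"
  define z where "z = y + complex_of_real (hs_norm y) \<cdot>\<^sub>m 1\<^sub>m d"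
  define w where "w = y + complex_of_real c \<cdot>\<^sub>m 1\<^sub>m d"
  have w: "w \<in> carrier_mat d d" and z: "z \<in> carrier_mat d d" using y by (auto simp: w_def z_def)
  have psd: "psd d w" "psd d z"
    using psd_add_scalar[OF y, of c] psd_add_scalar[OF y, of "hs_norm y"]
    by (simp_all add: w_def z_def c_def)
  have "mat_trace w = mat_trace z + of_nat d"
    using y by (simp add: mat_trace_def w_def z_def c_def sum.distrib algebra_simps)
  moreover have "0 \<le> mat_trace z"
    using psd_diag_nonneg[OF psd(2)] z by (auto simp: mat_trace_def intro!: sum_nonneg)
  ultimately have tr: "Im (mat_trace w) = 0" "Re (mat_trace w) > 0"
    using d by (auto simp: less_eq_complex_def)
  define t where "t = Re (mat_trace w)"
  have t: "t > 0" "mat_trace w = complex_of_real t" using tr by (auto simp: t_def complex_eq_iff)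
  define \<rho> where "\<rho> = complex_of_real (1 / t) \<cdot>\<^sub>m w"
  have "density_matrix d \<rho>"
    unfolding density_matrix_def
  proof
    have \<rho>: "\<rho> \<in> carrier_mat d d" using w by (simp add: \<rho>_def)
    show "psd d \<rho>" unfolding psd_iff[OF \<rho>]
    proof
      fix v
      have "(\<Sum>k<d. \<Sum>l<d. cnj (v k) * \<rho> $$ (k, l) * v l) =
          complex_of_real (1 / t) * (\<Sum>k<d. \<Sum>l<d. cnj (v k) * w $$ (k, l) * v l)"
        using w unfolding sum_distrib_left by (intro sum.cong) (auto simp: \<rho>_def)
      moreover have "0 \<le> complex_of_real (1 / t)" using t by (simp add: less_eq_complex_def)
      ultimately show "0 \<le> (\<Sum>k<d. \<Sum>l<d. cnj (v k) * \<rho> $$ (k, l) * v l)"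
        using psd(1)[unfolded psd_iff[OF w], rule_format, of v] by (simp only: mult_nonneg_nonneg)
    qed
    show "mat_trace \<rho> = 1" using t w by (simp add: \<rho>_def mat_trace_smult)
  qed
  moreover have "\<Phi> w = w"
    using lin un y fixed unfolding w_def linear_on_mats_def unital_def by (metis one_carrier_mat smult_carrier_mat)
  then have "\<Phi> \<rho> = \<rho>"
    using lin w unfolding \<rho>_def linear_on_mats_def by metis
  ultimately have \<rho>: "\<rho> = maximally_mixed d"
    using unique unfolding unique_fixed_state_def by blast
  have "w = complex_of_real t \<cdot>\<^sub>m \<rho>" using t w by (auto simp: \<rho>_def)
  then have wd: "w = (complex_of_real t / of_nat d) \<cdot>\<^sub>m 1\<^sub>m d"
    unfolding \<rho> maximally_mixed_def by auto
  define a where "a = complex_of_real t / of_nat d - complex_of_real c"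
  have "y = a \<cdot>\<^sub>m 1\<^sub>m d"
  proof (rule eq_matI)
    fix i j assume "i < dim_row (a \<cdot>\<^sub>m 1\<^sub>m d)" "j < dim_col (a \<cdot>\<^sub>m 1\<^sub>m d)"
    then have ij: "i < d" "j < d" by auto
    have "w $$ (i, j) = y $$ (i, j) + complex_of_real c * 1\<^sub>m d $$ (i, j)"
      using y ij by (simp add: w_def)
    moreover have "w $$ (i, j) = (complex_of_real t / of_nat d) * 1\<^sub>m d $$ (i, j)"
      using ij by (simp add: wd)
    ultimately show "y $$ (i, j) = (a \<cdot>\<^sub>m 1\<^sub>m d) $$ (i, j)"
      using ij by (simp add: a_def algebra_simps split: if_splits)
  qed (use y in auto)
  then show thesis by (rule that)
qed

text \<open>For a contraction, a fixed vector of the adjoint is a fixed vector of the map.\<close>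

lemma hs_adjoint_fixed_imp_fixed:
  assumes cp: "completely_positive d \<Phi>" and un: "unital d \<Phi>" and tp: "trace_preserving d \<Phi>"
    and adj: "is_hs_adjoint d \<Phi> \<Psi>" and y: "y \<in> carrier_mat d d" and fixed: "\<Psi> y = y"
  shows "\<Phi> y = y"
proof -
  have \<Phi>y: "\<Phi> y \<in> carrier_mat d d" using cp y by (simp add: completely_positive_def linear_on_mats_def)
  have "hs_inner y (\<Phi> y) = hs_inner y y"
    using adj y fixed unfolding is_hs_adjoint_def by metis
  then have "hs_inner (\<Phi> y) y = hs_inner y y"
    using hs_inner_commute[OF y \<Phi>y] by (simp add: hs_inner_self)
  \<comment> \<open>The cross term is the squared norm of y, so the expansion leaves a difference
    that contractivity makes nonpositive.\<close>
  then have "(hs_norm (\<Phi> y - y))\<^sup>2 = (hs_norm (\<Phi> y))\<^sup>2 - (hs_norm y)\<^sup>2"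
    unfolding hs_norm_minus_square[OF \<Phi>y y] by (simp add: hs_inner_self del: of_real_power)
  also have "\<dots> \<le> 0" using hs_norm_channel_le[OF cp un tp y] by (simp add: power_mono)
  finally have "hs_norm (\<Phi> y - y) = 0" by simp
  then have 0: "\<Phi> y - y = 0\<^sub>m d d"
    using hs_norm_eq_0_iff[OF minus_carrier_mat[OF y]] by blast
  show ?thesis
  proof (rule eq_matI)
    fix i j assume "i < dim_row y" "j < dim_col y"
    then have "(\<Phi> y - y) $$ (i, j) = 0" using y unfolding 0 by simp
    then show "\<Phi> y $$ (i, j) = y $$ (i, j)" using \<open>i < dim_row y\<close> \<open>j < dim_col y\<close> \<Phi>y y by simp
  qed (use \<Phi>y y in auto)
qed

section \<open>Compactness in coordinates\<close>

lemma convergent_subsequence_real: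
  fixes f :: "nat \<Rightarrow> real"
  assumes "\<And>n. \<bar>f n\<bar> \<le> b"
  obtains r l where "strict_mono r" "(\<lambda>n. f (r n)) \<longlonglongrightarrow> l"
proof -
  obtain r :: "nat \<Rightarrow> nat" where r: "strict_mono r" "monoseq (\<lambda>n. f (r n))"
    using seq_monosub by blast
  have "Bseq (\<lambda>n. f (r n))" using assms by (intro BseqI'[of _ b]) simp
  with r(2) have "convergent (\<lambda>n. f (r n))" by (rule Bseq_monoseq_convergent[rotated])
  then show thesis using that r(1) by (auto simp: convergent_def)
qed

text \<open>Bolzano-Weierstrass, refining the subsequence once for each index; limits already
  obtained survive the refinement.\<close>

lemma convergent_subsequence_family:
  fixes f :: "nat \<Rightarrow> 'i \<Rightarrow> real"
  assumes "finite I" "\<And>n i. i \<in> I \<Longrightarrow> \<bar>f n i\<bar> \<le> b"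
  shows "\<exists>r l. strict_mono (r :: nat \<Rightarrow> nat) \<and> (\<forall>i\<in>I. (\<lambda>n. f (r n) i) \<longlonglongrightarrow> l i)"
  using assms
proof (induction I rule: finite_induct)
  case empty
  show ?case by (intro exI[of _ id]) (auto simp: strict_mono_def)
next
  case (insert k I)
  then obtain r l where r: "strict_mono (r :: nat \<Rightarrow> nat)" and l: "\<And>i. i \<in> I \<Longrightarrow> (\<lambda>n. f (r n) i) \<longlonglongrightarrow> l i"
    by (metis insertCI)
  obtain q m where q: "strict_mono q" and m: "(\<lambda>n. f (r (q n)) k) \<longlonglongrightarrow> m"
    using convergent_subsequence_real[of "\<lambda>n. f (r n) k" b] insert.prems by auto
  have "strict_mono (r \<circ> q)" using r q by (rule strict_mono_o)
  moreover have "(\<lambda>n. f ((r \<circ> q) n) i) \<longlonglongrightarrow> (l(k := m)) i" if "i \<in> insert k I" for i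
    using that insert.hyps(2) m LIMSEQ_subseq_LIMSEQ[OF l q] by (auto simp: o_def)
  ultimately show ?case by blast
qed

text \<open>On traceless self-adjoint matrices the kernel of the semi-norm is trivial, since a
  traceless scalar matrix is 0. Were there no such c, normalised counterexamples would accumulate at
  a unit vector of this kernel.\<close>

lemma comm_seminorm_coercive:
  assumes finite: "finite S" and S: "S \<subseteq> carrier_mat d d"
    and scalar: "\<And>y. y \<in> commutant d S \<Longrightarrow> self_adjoint y \<Longrightarrow> \<exists>a. y = a \<cdot>\<^sub>m 1\<^sub>m d"
  obtains c where "\<And>x. x \<in> carrier_mat d d \<Longrightarrow> self_adjoint x \<Longrightarrow> mat_trace x = 0 \<Longrightarrow>
    hs_norm x \<le> c * comm_seminorm S x"
proof (rule ccontr)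
  note N_smult = comm_seminorm_smult_le[OF finite S] and N_nonneg = comm_seminorm_nonneg[OF finite S]
  assume "\<not> thesis"
  then have "\<exists>x. x \<in> carrier_mat d d \<and> self_adjoint x \<and> mat_trace x = 0 \<and>
      real (Suc n) * comm_seminorm S x < hs_norm x" for n
    using that by (meson not_le)
  then obtain x where x: "\<And>n. x n \<in> carrier_mat d d" "\<And>n. self_adjoint (x n)"
    "\<And>n. mat_trace (x n) = 0" "\<And>n. real (Suc n) * comm_seminorm S (x n) < hs_norm (x n)"
    by metis
  \<comment> \<open>The strict inequality gives this even where the semi-norm vanishes.\<close>
  have pos: "0 < hs_norm (x n)" for n
    using x(4)[of n] N_nonneg[of "x n"] by (meson le_less_trans mult_nonneg_nonneg of_nat_0_le_iff)
  define u where "u n = complex_of_real (1 / hs_norm (x n)) \<cdot>\<^sub>m x n" for n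
  have u: "u n \<in> carrier_mat d d" "self_adjoint (u n)" "mat_trace (u n) = 0" for n
    using x[of n] unfolding u_def
    by (auto simp: mat_trace_smult intro!: self_adjoint_smult_of_real simp del: of_real_divide)
  have u1: "hs_norm (u n) = 1" for n
    using pos[of n] by (simp add: u_def hs_norm_smult norm_divide)
  have uN: "comm_seminorm S (u n) \<le> inverse (real (Suc n))" for n
  proof -
    have "comm_seminorm S (u n) \<le> comm_seminorm S (x n) / hs_norm (x n)"
      using N_smult[OF x(1), of "complex_of_real (1 / hs_norm (x n))" n] pos[of n]
      by (simp add: u_def norm_divide)
    also have "\<dots> \<le> inverse (real (Suc n))"
      using x(4)[of n] pos[of n] by (simp add: field_simps)
    finally show ?thesis .
  qed
  have u_le: "cmod (u n $$ (i, j)) \<le> 1" if "i < d" "j < d" for n i j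
  proof -
    have "cmod (u n $$ (i, j)) \<le> hs_norm (u n)"
      unfolding hs_norm_def using that u(1)[of n] by (intro member_le_L2_set) auto
    then show ?thesis by (simp add: u1)
  qed
  \<comment> \<open>The Boolean component of an index selects the real part (\<open>True\<close>) or
    the imaginary part (\<open>False\<close>) of an entry.\<close>
  have "\<exists>r l. strict_mono (r :: nat \<Rightarrow> nat) \<and> (\<forall>k\<in>({..<d} \<times> {..<d}) \<times> (UNIV :: bool set).
      (\<lambda>n. (if snd k then Re (u (r n) $$ fst k) else Im (u (r n) $$ fst k))) \<longlonglongrightarrow> l k)"
    using u_le by (intro convergent_subsequence_family[where b = 1])
      (auto intro: order_trans[OF abs_Re_le_cmod] order_trans[OF abs_Im_le_cmod])
  then obtain r l where r: "strict_mono (r :: nat \<Rightarrow> nat)"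
    and l: "\<And>k. k \<in> ({..<d} \<times> {..<d}) \<times> (UNIV :: bool set) \<Longrightarrow>
      (\<lambda>n. (if snd k then Re (u (r n) $$ fst k) else Im (u (r n) $$ fst k))) \<longlonglongrightarrow> l k"
    by blast
  define y where "y = mat d d (\<lambda>ij. Complex (l (ij, True)) (l (ij, False)))"
  have y: "y \<in> carrier_mat d d" by (simp add: y_def)
  have lim: "(\<lambda>n. u (r n) $$ (i, j)) \<longlonglongrightarrow> y $$ (i, j)" if "i < d" "j < d" for i j
    using tendsto_Complex[OF l[of "((i, j), True)"] l[of "((i, j), False)"]] that
    by (simp add: y_def)
  have "cnj (y $$ (j, i)) = y $$ (i, j)" if "i < d" "j < d" for i j
  proof (rule LIMSEQ_unique)
    show "(\<lambda>n. u (r n) $$ (i, j)) \<longlonglongrightarrow> y $$ (i, j)" using that by (rule lim)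
    show "(\<lambda>n. u (r n) $$ (i, j)) \<longlonglongrightarrow> cnj (y $$ (j, i))"
      using tendsto_cnj[OF lim[OF that(2,1)]] u(2)[of "r n" for n, unfolded self_adjoint_iff[OF u(1)]] that
      by simp
  qed
  then have sa: "self_adjoint y" by (simp add: self_adjoint_iff[OF y])
  have tr: "mat_trace y = 0"
  proof (rule LIMSEQ_unique)
    show "(\<lambda>n. mat_trace (u (r n))) \<longlonglongrightarrow> mat_trace y"
      using carrier_matD(1)[OF u(1)] y by (auto simp: mat_trace_def intro!: tendsto_sum lim)
  qed (simp add: u(3))
  have "(hs_norm y)\<^sup>2 = 1"
  proof (rule LIMSEQ_unique)
    have "(\<lambda>n. \<Sum>(i, j)\<in>{..<d} \<times> {..<d}. (cmod (u (r n) $$ (i, j)))\<^sup>2) \<longlonglongrightarrow>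
        (\<Sum>(i, j)\<in>{..<d} \<times> {..<d}. (cmod (y $$ (i, j)))\<^sup>2)"
      by (auto intro!: tendsto_sum tendsto_power tendsto_norm lim)
    moreover have "(\<Sum>(i, j)\<in>{..<d} \<times> {..<d}. (cmod (u n $$ (i, j)))\<^sup>2) = (hs_norm (u n))\<^sup>2" for n
      using u(1)[of n] by (simp add: hs_norm_square case_prod_unfold)
    ultimately show "(\<lambda>n. (hs_norm (u (r n)))\<^sup>2) \<longlonglongrightarrow> (hs_norm y)\<^sup>2"
      using y by (simp add: hs_norm_square case_prod_unfold)
  qed (simp add: u1)
  have "s * y = y * s" if s: "s \<in> S" for s
  proof (rule eq_matI)
    have sd: "s \<in> carrier_mat d d" using s S by auto
    fix i j assume "i < dim_row (y * s)" "j < dim_col (y * s)"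
    then have ij: "i < d" "j < d" using y sd by auto
    have entry: "(s * z - z * s) $$ (i, j) =
        (\<Sum>k<d. s $$ (i, k) * z $$ (k, j)) - (\<Sum>k<d. z $$ (i, k) * s $$ (k, j))"
      if "z \<in> carrier_mat d d" for z
      using that sd ij by (simp add: scalar_prod_def atLeast0LessThan)
    have "(\<lambda>n. (s * u (r n) - u (r n) * s) $$ (i, j)) \<longlonglongrightarrow> (s * y - y * s) $$ (i, j)"
      unfolding entry[OF u(1)] entry[OF y] using ij by (auto intro!: tendsto_intros lim)
    moreover have "(\<lambda>n. (s * u (r n) - u (r n) * s) $$ (i, j)) \<longlonglongrightarrow> 0"
    proof (rule tendsto_0_le[where K = 1])
      have "cmod ((s * u (r n) - u (r n) * s) $$ (i, j)) \<le> inverse (real (Suc (r n)))" for n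
        using cmod_commutator_le[OF finite S s u(1) ij] uN by (rule order_trans)
      then show "\<forall>\<^sub>F n in sequentially. norm ((s * u (r n) - u (r n) * s) $$ (i, j)) \<le>
          norm (inverse (real (Suc (r n)))) * 1"
        by simp
      show "(\<lambda>n. inverse (real (Suc (r n)))) \<longlonglongrightarrow> 0"
        using LIMSEQ_subseq_LIMSEQ[OF LIMSEQ_inverse_real_of_nat r] by (simp add: o_def)
    qed
    ultimately have "(s * y - y * s) $$ (i, j) = 0" by (rule LIMSEQ_unique)
    then show "(s * y) $$ (i, j) = (y * s) $$ (i, j)" using sd y ij by simp
  qed (use S s y in auto)
  then have "y \<in> commutant d S" using y by (simp add: commutant_def)
  then obtain a where a: "y = a \<cdot>\<^sub>m 1\<^sub>m d" using scalar sa by blast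
  then have "a * of_nat d = 0" using tr by (simp add: mat_trace_smult)
  then have "y = 0\<^sub>m d d" using a by (auto simp: mat_eq_iff)
  then have "hs_norm y = 0" using hs_norm_eq_0_iff[OF y] by simp
  with \<open>(hs_norm y)\<^sup>2 = 1\<close> show False by simp
qed

section \<open>Contraction of the channel on traceless matrices\<close>

text \<open>Put b = a 1 / a 0. Repeated doubling gives b^(2^k) \<le> a(2^k) / a 0, which is at most
  (C / a 0) q^(2^k). If b exceeded q, the powers of b / q would outgrow every constant, so C has no
  influence on the conclusion.\<close>

lemma log_convex_sequence_le:
  fixes a :: "nat \<Rightarrow> real"
  assumes nonneg: "\<And>n. 0 \<le> a n" and convex: "\<And>n. (a n)\<^sup>2 \<le> a 0 * a (2 * n)"
    and bound: "\<And>n. a n \<le> C * q ^ n" and q: "0 \<le> q"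
  shows "a 1 \<le> q * a 0"
proof (cases "a 0 = 0")
  case True
  then show ?thesis using convex[of 1] by simp
next
  case False
  then have pos: "0 < a 0" using nonneg[of 0] by simp
  define b where "b = a 1 / a 0"
  have b: "0 \<le> b" using nonneg by (simp add: b_def)
  have pow: "b ^ (2 ^ k) \<le> a (2 ^ k) / a 0" for k
  proof (induction k)
    case 0
    show ?case by (simp add: b_def)
  next
    case (Suc k)
    have "b ^ (2 ^ Suc k) = (b ^ (2 ^ k))\<^sup>2" by (simp add: power_mult[symmetric] mult.commute)
    also have "\<dots> \<le> (a (2 ^ k) / a 0)\<^sup>2" using Suc b by (intro power_mono) auto
    also have "\<dots> = (a (2 ^ k))\<^sup>2 / (a 0)\<^sup>2" by (simp add: power_divide)
    also have "\<dots> \<le> a 0 * a (2 ^ Suc k) / (a 0)\<^sup>2"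
      using convex[of "2 ^ k"] by (simp add: divide_right_mono)
    also have "\<dots> = a (2 ^ Suc k) / a 0" using pos by (simp add: power2_eq_square)
    finally show ?case .
  qed
  have "b \<le> q"
  proof (rule ccontr)
    assume "\<not> b \<le> q"
    then have bq: "q < b" by simp
    show False
    \<comment> \<open>The main case divides by q; for q = 0 the bound at n = 1 already gives a 1
      \<le> 0.\<close>
    proof (cases "q = 0")
      case True
      then have "a 1 \<le> 0" using bound[of 1] by simp
      then show False using bq True pos by (simp add: b_def field_simps)
    next
      case False
      then have q: "0 < q" using q by simp
      then obtain n where n: "C / a 0 < (b / q) ^ n"
        using bq real_arch_pow[of "b / q" "C / a 0"] by auto
      \<comment> \<open>Only exponents that are powers of 2 are controlled; as b / q > 1, passing
        from n to 2^n loses nothing.\<close>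
      have "(b / q) ^ n \<le> (b / q) ^ (2 ^ n)"
        using bq q by (intro power_increasing) auto
      also have "\<dots> \<le> C / a 0"
      proof -
        have "b ^ (2 ^ n) \<le> C * q ^ (2 ^ n) / a 0"
          using pow[of n] bound[of "2 ^ n"] pos by (meson divide_right_mono less_imp_le order_trans)
        then show ?thesis using q by (simp add: power_divide field_simps)
      qed
      finally show False using n by simp
    qed
  qed
  then show ?thesis using pos by (simp add: b_def field_simps)
qed

text \<open>\<open>Lip\<close> controls only self-adjoint matrices, so orbits of
  \<open>\<Psi>\<close> after \<open>\<Phi>\<close> must stay among them. The entries of
  \<open>\<Psi> x\<close> are its pairings with matrix units, up to conjugation; these move over to
  \<open>\<Phi>\<close>, which commutes with taking adjoints.\<close>

lemma hs_adjoint_self_adjoint: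
  assumes herm: "\<And>y. y \<in> carrier_mat d d \<Longrightarrow> \<Phi> (mat_adjoint y) = mat_adjoint (\<Phi> y)"
    and lin: "linear_on_mats d \<Phi>" and adj: "is_hs_adjoint d \<Phi> \<Psi>"
    and x: "x \<in> carrier_mat d d" "self_adjoint x"
  shows "self_adjoint (\<Psi> x)"
proof -
  have \<Psi>x: "\<Psi> x \<in> carrier_mat d d"
    using adj x by (simp add: is_hs_adjoint_def linear_on_mats_def)
  have inner_adjoint: "hs_inner x (mat_adjoint y) = cnj (hs_inner x y)" if y: "y \<in> carrier_mat d d" for y
  proof -
    have "cnj (hs_inner x y) = (\<Sum>i<d. \<Sum>j<d. x $$ (i, j) * cnj (y $$ (i, j)))"
      unfolding hs_inner_eq_sum[OF x(1) y] sum.cartesian_product[symmetric] by (simp add: cnj_sum)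
    also have "\<dots> = (\<Sum>j<d. \<Sum>i<d. cnj (x $$ (j, i)) * mat_adjoint y $$ (j, i))"
      using x y by (subst sum.swap, intro sum.cong refl)
        (simp add: self_adjoint_iff[OF x(1), THEN iffD1])
    finally show ?thesis
      unfolding hs_inner_eq_sum[OF x(1) mat_adjoint_carrier[OF y]] sum.cartesian_product[symmetric] by simp
  qed
  have "cnj (\<Psi> x $$ (j, i)) = \<Psi> x $$ (i, j)" if ij: "i < d" "j < d" for i j
  proof -
    define U :: "nat \<Rightarrow> nat \<Rightarrow> complex mat"
      where "U p q = mat d d (\<lambda>(k, l). if k = p \<and> l = q then 1 else 0)" for p q
    have U: "U p q \<in> carrier_mat d d" for p q by (simp add: U_def)
    have entry: "cnj (\<Psi> x $$ (p, q)) = hs_inner x (\<Phi> (U p q))" if "p < d" "q < d" for p q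
    proof -
      have "hs_inner (\<Psi> x) (U p q) = (\<Sum>k\<in>{..<d} \<times> {..<d}. if k = (p, q) then cnj (\<Psi> x $$ k) else 0)"
        unfolding hs_inner_eq_sum[OF \<Psi>x U] by (intro sum.cong) (auto simp: U_def split: if_splits)
      also have "\<dots> = cnj (\<Psi> x $$ (p, q))" using that by simp
      finally show ?thesis using adj x U by (simp add: is_hs_adjoint_def)
    qed
    have "U j i = mat_adjoint (U i j)" using ij by (auto simp: U_def mat_eq_iff)
    then have "cnj (\<Psi> x $$ (j, i)) = hs_inner x (mat_adjoint (\<Phi> (U i j)))"
      using entry[OF ij(2,1)] herm[OF U] by simp
    also have "\<dots> = cnj (hs_inner x (\<Phi> (U i j)))"
      using lin U by (intro inner_adjoint) (simp add: linear_on_mats_def)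
    also have "\<dots> = \<Psi> x $$ (i, j)" by (simp add: entry[OF ij, symmetric])
    finally show ?thesis .
  qed
  then show ?thesis by (simp add: self_adjoint_iff[OF \<Psi>x])
qed

lemma hs_norm_square_contraction:
  assumes d: "d \<ge> 1" and cp: "completely_positive d \<Phi>" and tp: "trace_preserving d \<Phi>"
    and un: "unital d \<Phi>" and unique: "unique_fixed_state d \<Phi> (maximally_mixed d)"
    and adj: "is_hs_adjoint d \<Phi> \<Psi>" and finite: "finite S" and S: "S \<subseteq> carrier_mat d d"
    and fixed: "\<And>y. y \<in> commutant d S \<Longrightarrow> \<Psi> y = y"
    and L: "Lip d S \<Phi> \<le> ereal L" "0 \<le> L" and M: "Lip d S \<Psi> \<le> ereal M" "0 \<le> M"
    and x: "x \<in> carrier_mat d d" "self_adjoint x" "mat_trace x = 0"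
  shows "(hs_norm (\<Phi> x))\<^sup>2 \<le> L * M * (hs_norm x)\<^sup>2"
proof -
  let ?N = "comm_seminorm S" and ?T = "\<lambda>y. \<Psi> (\<Phi> y)"
  have lin: "linear_on_mats d \<Phi>" using cp by (simp add: completely_positive_def)
  have lin': "linear_on_mats d \<Psi>" using adj by (simp add: is_hs_adjoint_def)
  have car: "\<Phi> y \<in> carrier_mat d d" "\<Psi> y \<in> carrier_mat d d" if "y \<in> carrier_mat d d" for y
    using lin lin' that by (auto simp: linear_on_mats_def)
  have inner: "hs_inner (\<Psi> y) z = hs_inner y (\<Phi> z)"
    if "y \<in> carrier_mat d d" "z \<in> carrier_mat d d" for y z
    using adj that by (simp add: is_hs_adjoint_def)
  have commutant_carrier: "y \<in> carrier_mat d d" if "y \<in> commutant d S" for y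
    using that by (simp add: commutant_def)
  have fixed\<Phi>: "\<Phi> y = y" if "y \<in> commutant d S" for y
    using hs_adjoint_fixed_imp_fixed[OF cp un tp adj commutant_carrier[OF that] fixed[OF that]] .
  have scalar: "\<exists>a. y = a \<cdot>\<^sub>m 1\<^sub>m d" if "y \<in> commutant d S" "self_adjoint y" for y
    using fixed_self_adjoint_is_scalar[OF lin un d unique commutant_carrier[OF that(1)] that(2) fixed\<Phi>[OF that(1)]]
    by blast
  obtain c where c: "\<And>y. y \<in> carrier_mat d d \<Longrightarrow> self_adjoint y \<Longrightarrow> mat_trace y = 0 \<Longrightarrow>
      hs_norm y \<le> c * ?N y"
    using comm_seminorm_coercive[OF finite S scalar] by blast
  have zero: "?N y = 0 \<longleftrightarrow> y \<in> commutant d S" if "y \<in> carrier_mat d d" for y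
    using comm_seminorm_eq_0_iff[OF finite S that] .
  have N_nonneg: "0 \<le> ?N y" for y using comm_seminorm_nonneg[OF finite S] .
  \<comment> \<open>Where the semi-norm is 0, y lies in the commutant and is fixed by F, so both
    sides vanish.\<close>
  have N_map: "?N (F y) \<le> K * ?N y"
    if F: "linear_on_mats d F" "Lip d S F \<le> ereal K" "\<And>y. y \<in> commutant d S \<Longrightarrow> F y = y"
      and y: "y \<in> carrier_mat d d" "self_adjoint y" for F K y
  proof (cases "?N y = 0")
    case True
    then show ?thesis using zero[OF y(1)] F(3) by simp
  next
    case False
    then have "0 < ?N y" using N_nonneg[of y] by simp
    then show ?thesis using comm_seminorm_map_le[OF finite S F(1,2) y] by blast
  qed
  have sa: "self_adjoint (\<Phi> y)" "self_adjoint (\<Psi> y)" if y: "y \<in> carrier_mat d d" "self_adjoint y" for y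
  proof -
    show "self_adjoint (\<Phi> y)"
      using completely_positive_adjoint[OF cp un y(1)] y(2) by (simp add: self_adjoint_def)
    show "self_adjoint (\<Psi> y)"
      using hs_adjoint_self_adjoint[OF completely_positive_adjoint[OF cp un] lin adj y] .
  qed
  \<comment> \<open>Dual to \<open>\<Phi>\<close> being unital. It keeps the orbit traceless, where
    the semi-norm controls the Hilbert-Schmidt norm.\<close>
  have tr\<Psi>: "mat_trace (\<Psi> y) = mat_trace y" if y: "y \<in> carrier_mat d d" for y
  proof -
    have "hs_inner (\<Psi> y) (1\<^sub>m d) = hs_inner y (1\<^sub>m d)"
      using inner[OF y, of "1\<^sub>m d"] un by (simp add: unital_def)
    then show ?thesis
      using hs_inner_commute[OF y, of "1\<^sub>m d"] hs_inner_commute[OF car(2)[OF y], of "1\<^sub>m d"]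
        hs_inner_one[OF y] hs_inner_one[OF car(2)[OF y]] by simp
  qed
  have iter: "(?T ^^ n) y \<in> carrier_mat d d \<and> self_adjoint ((?T ^^ n) y) \<and> mat_trace ((?T ^^ n) y) = mat_trace y
      \<and> ?N ((?T ^^ n) y) \<le> (L * M) ^ n * ?N y"
    if y: "y \<in> carrier_mat d d" "self_adjoint y" for n y
  proof (induction n)
    case (Suc n)
    define z where "z = (?T ^^ n) y"
    have z: "z \<in> carrier_mat d d" "self_adjoint z" "mat_trace z = mat_trace y" "?N z \<le> (L * M) ^ n * ?N y"
      using Suc by (auto simp: z_def)
    have "?N (?T z) \<le> M * ?N (\<Phi> z)"
      using N_map[OF lin' M(1) fixed car(1)[OF z(1)] sa(1)[OF z(1,2)]] .
    also have "\<dots> \<le> M * (L * ?N z)"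
      using N_map[OF lin L(1) fixed\<Phi> z(1,2)] M(2) by (intro mult_left_mono)
    also have "\<dots> \<le> M * (L * ((L * M) ^ n * ?N y))"
      using z(4) M(2) L(2) by (intro mult_left_mono)
    finally have "?N (?T z) \<le> (L * M) ^ Suc n * ?N y" by (simp add: mult_ac)
    moreover have "mat_trace (?T z) = mat_trace y"
      using tr\<Psi>[OF car(1)[OF z(1)]] tp z by (simp add: trace_preserving_def)
    ultimately show ?case using z car sa by (simp add: z_def[symmetric])
  qed (use y in simp)
  have T_car: "(?T ^^ n) y \<in> carrier_mat d d" if "y \<in> carrier_mat d d" for n y
    using that car by (induction n) auto
  have T_inner: "hs_inner (?T y) z = hs_inner y (?T z)"
    if yz: "y \<in> carrier_mat d d" "z \<in> carrier_mat d d" for y z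
  proof -
    have "hs_inner y (?T z) = cnj (hs_inner (?T z) y)"
      using hs_inner_commute[OF car(2)[OF car(1)[OF yz(2)]] yz(1)] .
    also have "hs_inner (?T z) y = hs_inner (\<Phi> z) (\<Phi> y)"
      using inner[OF car(1)[OF yz(2)] yz(1)] .
    also have "cnj (hs_inner (\<Phi> z) (\<Phi> y)) = hs_inner (\<Phi> y) (\<Phi> z)"
      using hs_inner_commute[OF car(1)[OF yz(2)] car(1)[OF yz(1)]] by simp
    finally show ?thesis using inner[OF car(1)[OF yz(1)] yz(2)] by simp
  qed
  have T_pow_inner: "hs_inner ((?T ^^ n) y) z = hs_inner y ((?T ^^ n) z)"
    if "y \<in> carrier_mat d d" "z \<in> carrier_mat d d" for n y z
    using that
  proof (induction n arbitrary: z)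
    case (Suc n)
    have "hs_inner ((?T ^^ Suc n) y) z = hs_inner ((?T ^^ n) y) (?T z)"
      using T_inner[OF T_car[OF Suc.prems(1)] Suc.prems(2)] by simp
    also have "\<dots> = hs_inner y ((?T ^^ n) (?T z))"
      using Suc.IH[OF Suc.prems(1) car(2)[OF car(1)[OF Suc.prems(2)]]] .
    also have "(?T ^^ n) (?T z) = (?T ^^ Suc n) z" by (simp only: funpow_Suc_right o_apply)
    finally show ?case .
  qed simp
  define a where "a n = hs_norm ((?T ^^ n) x)" for n
  have "a 1 \<le> (L * M) * a 0"
  proof (rule log_convex_sequence_le)
    show "0 \<le> a n" for n by (simp add: a_def)
    show "0 \<le> L * M" using L(2) M(2) by simp
    \<comment> \<open>Moving n copies of the self-adjoint map across the inner product and applying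
      Cauchy-Schwarz gives log-convexity.\<close>
    show "(a n)\<^sup>2 \<le> a 0 * a (2 * n)" for n
    proof -
      have "complex_of_real ((a n)\<^sup>2) = hs_inner ((?T ^^ n) x) ((?T ^^ n) x)"
        by (simp add: a_def hs_inner_self)
      also have "\<dots> = hs_inner x ((?T ^^ (2 * n)) x)"
        using T_pow_inner[OF x(1) T_car[OF x(1)], of n n] by (simp add: mult_2 funpow_add)
      finally have "(a n)\<^sup>2 = cmod (hs_inner x ((?T ^^ (2 * n)) x))"
        by (metis abs_of_nonneg norm_of_real zero_le_power2)
      also have "\<dots> \<le> a 0 * a (2 * n)"
        using cmod_hs_inner_le[OF x(1) T_car[OF x(1)]] by (simp add: a_def)
      finally show ?thesis .
    qed
    show "a n \<le> (\<bar>c\<bar> * ?N x) * (L * M) ^ n" for n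
    proof -
      note it = iter[OF x(1,2), of n]
      have "a n \<le> c * ?N ((?T ^^ n) x)" unfolding a_def using it x(3) by (intro c) auto
      also have "\<dots> \<le> \<bar>c\<bar> * ?N ((?T ^^ n) x)" using N_nonneg by (intro mult_right_mono) auto
      also have "\<dots> \<le> \<bar>c\<bar> * ((L * M) ^ n * ?N x)" using it by (intro mult_left_mono) auto
      finally show ?thesis by (simp add: mult_ac)
    qed
  qed
  then have T_le: "hs_norm (?T x) \<le> L * M * hs_norm x" by (simp add: a_def)
  \<comment> \<open>Back from the composite map to \<open>\<Phi>\<close>: a factor L M for the
    composite bounds the square of the norm of \<open>\<Phi> x\<close>.\<close>
  have "complex_of_real ((hs_norm (\<Phi> x))\<^sup>2) = hs_inner (?T x) x"
    using inner[OF car(1)[OF x(1)] x(1)] by (simp add: hs_inner_self)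
  then have "(hs_norm (\<Phi> x))\<^sup>2 = cmod (hs_inner (?T x) x)"
    by (metis abs_of_nonneg norm_of_real zero_le_power2)
  also have "\<dots> \<le> hs_norm (?T x) * hs_norm x"
    using cmod_hs_inner_le[OF car(2)[OF car(1)[OF x(1)]] x(1)] .
  also have "\<dots> \<le> L * M * hs_norm x * hs_norm x"
    using T_le by (intro mult_right_mono) auto
  finally show ?thesis by (simp add: power2_eq_square mult.assoc)
qed

section \<open>The trace norm\<close>

text \<open>Translates the algebraic multiplicities in \<open>trace_norm\<close> into occurrences in
  a list of eigenvalues.\<close>

lemma order_prod_list_linear:
  fixes es :: "complex list"
  shows "Polynomial.order z (\<Prod>e\<leftarrow>es. [:- e, 1:]) = count_list es z"
proof (induction es)
  case (Cons e es)
  have "(\<Prod>e\<leftarrow>es. [:- e, 1:]) \<noteq> 0" by (auto simp: prod_list_zero_iff)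
  then have "Polynomial.order z ([:- e, 1:] * (\<Prod>e\<leftarrow>es. [:- e, 1:])) =
      Polynomial.order z [:- e, 1:] + Polynomial.order z (\<Prod>e\<leftarrow>es. [:- e, 1:])"
    by (intro order_mult) (simp del: mult_pCons_left)
  moreover have "Polynomial.order z [:- e, 1:] = (if e = z then 1 else 0)"
    using order_linear_power[of z "- e" 1] by simp
  ultimately show ?case using Cons.IH by (simp del: mult_pCons_left)
qed simp

lemma sum_count_list_mult:
  fixes f :: "'a \<Rightarrow> real"
  assumes "finite X" "set xs \<subseteq> X"
  shows "(\<Sum>x\<in>X. of_nat (count_list xs x) * f x) = (\<Sum>x\<leftarrow>xs. f x)"
  using assms(2)
proof (induction xs)
  case (Cons y xs)
  have "(\<Sum>x\<in>X. of_nat (count_list (y # xs) x) * f x) =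
      (\<Sum>x\<in>X. of_nat (count_list xs x) * f x + (if x = y then f x else 0))"
    by (intro sum.cong) (auto simp: algebra_simps)
  then show ?case using Cons assms(1) by (simp add: sum.distrib)
qed simp

lemma mat_trace_mult_commute:
  assumes "A \<in> carrier_mat n m" "B \<in> carrier_mat m n"
  shows "mat_trace (A * B) = mat_trace (B * A)"
proof -
  have "mat_trace (A * B) = (\<Sum>i<n. \<Sum>j<m. A $$ (i, j) * B $$ (j, i))"
    using assms by (simp add: mat_trace_def scalar_prod_def atLeast0LessThan)
  also have "\<dots> = (\<Sum>j<m. \<Sum>i<n. B $$ (j, i) * A $$ (i, j))"
    by (subst sum.swap) (simp add: mult.commute)
  finally show ?thesis
    using assms by (simp add: mat_trace_def scalar_prod_def atLeast0LessThan)
qed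

text \<open>Schur triangularisation: similar matrices have the same trace, and the triangular one
  carries \<open>es\<close> on its diagonal.\<close>

lemma mat_trace_eq_sum_eigenvalues:
  fixes A :: "complex mat"
  assumes A: "A \<in> carrier_mat n n" and es: "char_poly A = (\<Prod>e\<leftarrow>es. [:- e, 1:])"
  shows "mat_trace A = sum_list es"
proof -
  obtain B P Q where schur: "schur_decomposition A es = (B, P, Q)"
    by (metis prod_cases3)
  note sd = schur_decomposition[OF A es schur]
  have PQ: "B \<in> carrier_mat n n" "P \<in> carrier_mat n n" "Q \<in> carrier_mat n n"
    "Q * P = 1\<^sub>m n" "A = P * B * Q"
    using similar_mat_witD2[OF A sd[THEN conjunct1]] by simp_all
  have "mat_trace A = mat_trace (Q * (P * B))"
    using mat_trace_mult_commute[OF mult_carrier_mat[OF PQ(2,1)] PQ(3)] by (simp only: PQ(5))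
  also have "Q * (P * B) = B"
    using assoc_mult_mat[OF PQ(3,2,1)] PQ(4) left_mult_one_mat[OF PQ(1)] by simp
  also have "mat_trace B = sum_list (diag_mat B)"
    using PQ by (simp add: mat_trace_def diag_mat_def sum_list_sum_nth atLeast0LessThan)
  finally show ?thesis using sd by simp
qed

text \<open>Cauchy-Schwarz for the d singular values against the constant 1: their squares add up to
  the trace of \<open>mat_adjoint x * x\<close>, the squared Hilbert-Schmidt norm.\<close>

lemma trace_norm_le:
  assumes x: "x \<in> carrier_mat d d"
  shows "trace_norm x \<le> sqrt (real d) * hs_norm x"
proof -
  define y where "y = mat_adjoint x * x"
  have y: "y \<in> carrier_mat d d" unfolding y_def using x by (intro mult_carrier_mat) auto
  obtain es where es: "char_poly y = (\<Prod>e\<leftarrow>es. [:- e, 1:])" and len: "length es = d"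
    using char_poly_factorized[OF y] by auto
  have spec: "spectrum y = set es"
    unfolding spectrum_root_char_poly[OF y] es by (auto simp: poly_prod_list prod_list_zero_iff)
  have "psd d y"
  proof -
    have "mat_adjoint (mat_adjoint x) = x" by (rule eq_matI) auto
    then show ?thesis using psd_mult_adjoint[OF mat_adjoint_carrier[OF x]] by (simp add: y_def)
  qed
  \<comment> \<open>Needed so that squaring \<open>sqrt (Re e)\<close> returns
    \<open>Re e\<close>.\<close>
  have nonneg: "0 \<le> Re e" if e: "e \<in> set es" for e
  proof -
    obtain v where v: "v \<in> carrier_vec d" "v \<noteq> 0\<^sub>v d" "y *\<^sub>v v = e \<cdot>\<^sub>v v"
      using e y unfolding spec[symmetric] by (auto simp: spectrum_def eigenvalue_def eigenvector_def)
    have "0 \<le> e * (v \<bullet>c v)"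
      using \<open>psd d y\<close> v unfolding psd_def by (metis carrier_vec_conjugate smult_scalar_prod_distrib)
    moreover have "0 < v \<bullet>c v" using v by simp
    ultimately show ?thesis by (auto simp: less_eq_complex_def less_complex_def zero_le_mult_iff)
  qed
  have "trace_norm x = (\<Sum>e\<in>set es. of_nat (count_list es e) * sqrt (Re e))"
    by (simp add: trace_norm_def Let_def y_def[symmetric] spec es order_prod_list_linear)
  also have "\<dots> = (\<Sum>e\<leftarrow>es. sqrt (Re e))"
    by (rule sum_count_list_mult) simp_all
  also have "\<dots> = (\<Sum>i<d. \<bar>1\<bar> * \<bar>sqrt (Re (es ! i))\<bar>)"
    using len nonneg by (simp add: sum_list_sum_nth atLeast0LessThan)
  also have "\<dots> \<le> L2_set (\<lambda>_. 1) {..<d} * L2_set (\<lambda>i. sqrt (Re (es ! i))) {..<d}"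
    by (rule L2_set_mult_ineq)
  also have "L2_set (\<lambda>i. sqrt (Re (es ! i))) {..<d} = sqrt (\<Sum>i<d. Re (es ! i))"
    unfolding L2_set_def using nonneg len by simp
  also have "(\<Sum>i<d. Re (es ! i)) = Re (sum_list es)"
    using len by (simp add: sum_list_sum_nth atLeast0LessThan)
  also have "sum_list es = hs_inner x x"
    using mat_trace_eq_sum_eigenvalues[OF y es] by (simp add: hs_inner_def y_def)
  also have "sqrt (Re (hs_inner x x)) = hs_norm x"
    by (simp add: hs_inner_self del: of_real_power)
  finally show ?thesis by (simp add: L2_set_def)
qed

section \<open>The mixing time\<close>

text \<open>The deviation from the maximally mixed state stays self-adjoint and traceless, so the
  contraction applies at every step. The prefactor d is the product of sqrt d from the initial norm
  and sqrt d from the trace norm.\<close>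

lemma trace_norm_iterate_le:
  assumes d: "d \<ge> 1" and lin: "linear_on_mats d \<Phi>" and un: "unital d \<Phi>"
    and tp: "trace_preserving d \<Phi>"
    and sa: "\<And>x. x \<in> carrier_mat d d \<Longrightarrow> self_adjoint x \<Longrightarrow> self_adjoint (\<Phi> x)"
    and contr: "\<And>x. x \<in> carrier_mat d d \<Longrightarrow> self_adjoint x \<Longrightarrow> mat_trace x = 0 \<Longrightarrow>
      (hs_norm (\<Phi> x))\<^sup>2 \<le> q * (hs_norm x)\<^sup>2"
    and q: "0 \<le> q" and \<rho>: "density_matrix d \<rho>"
  shows "trace_norm ((\<Phi> ^^ n) \<rho> - maximally_mixed d) \<le> real d * sqrt (q ^ n)"
proof -
  let ?m = "maximally_mixed d"
  define x where "x = \<rho> - ?m"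
  have \<rho>c: "\<rho> \<in> carrier_mat d d" and \<rho>sa: "self_adjoint \<rho>" and \<rho>tr: "mat_trace \<rho> = 1"
    using \<rho> psd_self_adjoint by (auto simp: density_matrix_def psd_def)
  have m: "?m \<in> carrier_mat d d" by (simp add: maximally_mixed_def)
  have msa: "self_adjoint ?m"
    unfolding self_adjoint_iff[OF m] by (simp add: maximally_mixed_def)
  have mtr: "mat_trace ?m = 1" using d by (simp add: maximally_mixed_def mat_trace_smult)
  have x: "x \<in> carrier_mat d d" "self_adjoint x" "mat_trace x = 0"
    using \<rho>c \<rho>sa \<rho>tr m msa mtr
    by (auto simp: x_def mat_trace_minus intro!: self_adjoint_minus)
  have "\<Phi> ?m = ?m"
    using lin un unfolding maximally_mixed_def linear_on_mats_def unital_def by (metis one_carrier_mat)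
  then have pow_m: "(\<Phi> ^^ n) ?m = ?m" for n by (induction n) auto
  have iter: "(\<Phi> ^^ n) x \<in> carrier_mat d d \<and> self_adjoint ((\<Phi> ^^ n) x) \<and> mat_trace ((\<Phi> ^^ n) x) = 0
      \<and> (hs_norm ((\<Phi> ^^ n) x))\<^sup>2 \<le> q ^ n * (hs_norm x)\<^sup>2 \<and> (\<Phi> ^^ n) \<rho> = (\<Phi> ^^ n) x + ?m" for n
  proof (induction n)
    case 0
    have "\<rho> = x + ?m" using \<rho>c m unfolding x_def by (intro eq_matI) auto
    then show ?case using x by simp
  next
    case (Suc n)
    define y where "y = (\<Phi> ^^ n) x"
    have y: "y \<in> carrier_mat d d" "self_adjoint y" "mat_trace y = 0"
      "(hs_norm y)\<^sup>2 \<le> q ^ n * (hs_norm x)\<^sup>2" "(\<Phi> ^^ n) \<rho> = y + ?m"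
      using Suc by (auto simp: y_def)
    have "(hs_norm (\<Phi> y))\<^sup>2 \<le> q * (q ^ n * (hs_norm x)\<^sup>2)"
      using contr[OF y(1-3)] mult_left_mono[OF y(4) q] by linarith
    moreover have "\<Phi> (y + ?m) = \<Phi> y + ?m"
      using lin y(1) m \<open>\<Phi> ?m = ?m\<close> unfolding linear_on_mats_def by metis
    ultimately show ?case
      using y sa[OF y(1,2)] lin tp
      by (simp add: y_def[symmetric] linear_on_mats_def trace_preserving_def mult.assoc)
  qed
  have inner_m: "hs_inner z ?m = 1 / of_nat d" if z: "z \<in> carrier_mat d d" "mat_trace z = 1" for z
    using hs_inner_smult_right[OF z(1) one_carrier_mat] hs_inner_commute[OF one_carrier_mat z(1)]
      hs_inner_one[OF z(1)] z(2) by (simp add: maximally_mixed_def)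
  have "complex_of_real ((hs_norm ?m)\<^sup>2) = complex_of_real (1 / real d)"
    using inner_m[OF m mtr] by (simp add: hs_inner_self)
  then have m_norm: "(hs_norm ?m)\<^sup>2 = 1 / real d" unfolding of_real_eq_iff .
  \<comment> \<open>Pythagoras: every matrix of trace 1 pairs with the maximally mixed state to 1/d,
    so subtracting that state shortens \<open>\<rho>\<close>.\<close>
  have "(hs_norm x)\<^sup>2 = (hs_norm \<rho>)\<^sup>2 - 1 / real d"
    unfolding x_def hs_norm_minus_square[OF \<rho>c m] m_norm inner_m[OF \<rho>c \<rho>tr] by (simp add: Re_divide_of_nat)
  moreover have "0 \<le> 1 / real d" by simp
  ultimately have "(hs_norm x)\<^sup>2 \<le> real d"
    using hs_norm_density_matrix_le[OF \<rho>] by linarith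
  then have "(hs_norm ((\<Phi> ^^ n) x))\<^sup>2 \<le> q ^ n * real d"
    using iter[of n] mult_left_mono[of "(hs_norm x)\<^sup>2" "real d" "q ^ n"] q by auto
  then have bound: "hs_norm ((\<Phi> ^^ n) x) \<le> sqrt (q ^ n * real d)"
    by (rule real_le_rsqrt)
  have "(\<Phi> ^^ n) \<rho> - ?m = (\<Phi> ^^ n) x"
    using iter[of n] m by (intro eq_matI) auto
  then have "trace_norm ((\<Phi> ^^ n) \<rho> - ?m) \<le> sqrt (real d) * hs_norm ((\<Phi> ^^ n) x)"
    using trace_norm_le[of "(\<Phi> ^^ n) x" d] iter[of n] by simp
  also have "\<dots> \<le> sqrt (real d) * sqrt (q ^ n * real d)"
    using bound by (intro mult_left_mono) auto
  also have "\<dots> = real d * sqrt (q ^ n)"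
    by (simp add: real_sqrt_mult)
  finally show ?thesis .
qed

lemma t_mix_le:
  assumes "n \<ge> 1"
    and "\<And>\<rho>. density_matrix d \<rho> \<Longrightarrow> trace_norm ((\<Phi> ^^ n) \<rho> - maximally_mixed d) \<le> \<epsilon>"
  shows "t_mix d \<epsilon> \<Phi> \<le> ereal (real n)"
  unfolding t_mix_def using assms by (intro Inf_lower) blast

lemma exists_power_le:
  fixes q \<epsilon> :: real
  assumes q: "0 < q" "q < 1" and \<epsilon>: "0 < \<epsilon>" "\<epsilon> < 1" and d: "d \<ge> (1 :: nat)"
  obtains n :: nat where "n \<ge> 1" "real d * sqrt (q ^ n) \<le> \<epsilon>"
    "real n \<le> max 1 (4 * ((ln (1 / \<epsilon>) + ln (real d)) / - ln q))"
proof -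
  define X where "X = (ln (1 / \<epsilon>) + ln (real d)) / - ln q"
  \<comment> \<open>The factor 2 compensates the square root of q; the maximum with 1 respects that
    mixing times start at 1.\<close>
  define n where "n = max 1 (nat \<lceil>2 * X\<rceil>)"
  have lnq: "ln q < 0" using q by simp
  have A: "0 \<le> ln (1 / \<epsilon>)" "0 \<le> ln (real d)" using \<epsilon> d by (auto simp: ln_div)
  then have X: "0 \<le> X" unfolding X_def using lnq by (intro divide_nonneg_pos) auto
  have "2 * X \<le> real n" unfolding n_def by linarith
  then have "2 * (ln (1 / \<epsilon>) + ln (real d)) \<le> real n * - ln q"
    using lnq by (simp add: X_def field_simps)
  then have "ln (q ^ n) \<le> ln ((\<epsilon> / real d)\<^sup>2)"
    using q \<epsilon> d by (simp add: ln_realpow ln_div algebra_simps)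
  then have "q ^ n \<le> (\<epsilon> / real d)\<^sup>2"
    using q \<epsilon> d by (subst (asm) ln_le_cancel_iff) auto
  then have "sqrt (q ^ n) \<le> \<epsilon> / real d"
    using \<epsilon> by (intro real_le_lsqrt) auto
  then have "real d * sqrt (q ^ n) \<le> \<epsilon>" using d by (simp add: field_simps)
  moreover have "real n \<le> max 1 (4 * X)"
  proof (cases "2 * X \<le> 1")
    case True
    then have "nat \<lceil>2 * X\<rceil> \<le> 1" by (simp add: ceiling_le_iff nat_le_iff)
    then show ?thesis by (simp add: n_def)
  next
    case False
    \<comment> \<open>Here 2 X > 1, so rounding up at most doubles the value.\<close>
    then have "real (nat \<lceil>2 * X\<rceil>) \<le> 4 * X" by linarith
    then show ?thesis by (simp add: n_def max.coboundedI2)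
  qed
  ultimately show thesis using that[of n] by (simp add: X_def n_def)
qed

text \<open>The maximum with 1 on the right reflects that \<open>t_mix\<close> ranges over n \<ge>
  1, while the quotient can be arbitrarily small, and is 0 when a Lipschitz constant
  vanishes.\<close>

theorem theorem1p5:
  shows "\<exists>c_abs::real. c_abs > 0 \<and>
    (\<forall>(d::nat) (\<Phi> :: complex mat \<Rightarrow> complex mat) (\<Phi>_adj :: complex mat \<Rightarrow> complex mat)
       (S :: complex mat set) (E :: complex mat \<Rightarrow> complex mat).
      d \<ge> 1 \<longrightarrow>
      completely_positive d \<Phi> \<longrightarrow> trace_preserving d \<Phi> \<longrightarrow> unital d \<Phi> \<longrightarrow>
      unique_fixed_state d \<Phi> (maximally_mixed d) \<longrightarrow>
      is_hs_adjoint d \<Phi> \<Phi>_adj \<longrightarrow>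
      finite S \<longrightarrow> S \<subseteq> carrier_mat d d \<longrightarrow>
      von_neumann_subalgebra d (commutant d S) \<longrightarrow>
      conditional_expectation d (commutant d S) E \<longrightarrow>
      (\<forall>x\<in>carrier_mat d d. \<Phi>_adj (E x) = E x) \<longrightarrow>
      Lip d S \<Phi> < 1 \<longrightarrow> Lip d S \<Phi>_adj \<le> 1 \<longrightarrow>
      (\<forall>\<epsilon>::real. 0 < \<epsilon> \<and> \<epsilon> < 1 \<longrightarrow>
        t_mix d \<epsilon> \<Phi> \<le>
          max 1 (ereal c_abs * (ereal (ln (1 / \<epsilon>) + ln (real d)) /
                   (- elog (Lip d S \<Phi>) - elog (Lip d S \<Phi>_adj))))))"
proof (intro exI[of _ 4] conjI allI impI)
  fix d :: nat and \<Phi> \<Phi>_adj :: "complex mat \<Rightarrow> complex mat" and S :: "complex mat set"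
    and E :: "complex mat \<Rightarrow> complex mat" and \<epsilon> :: real
  assume d: "d \<ge> 1" and cp: "completely_positive d \<Phi>" and tp: "trace_preserving d \<Phi>"
    and un: "unital d \<Phi>" and unique: "unique_fixed_state d \<Phi> (maximally_mixed d)"
    and adj: "is_hs_adjoint d \<Phi> \<Phi>_adj" and finite: "finite S" and S: "S \<subseteq> carrier_mat d d"
    and E: "conditional_expectation d (commutant d S) E"
    and \<Phi>E: "\<forall>x\<in>carrier_mat d d. \<Phi>_adj (E x) = E x"
    and Lip: "Lip d S \<Phi> < 1" and Lip': "Lip d S \<Phi>_adj \<le> 1" and \<epsilon>: "0 < \<epsilon> \<and> \<epsilon> < 1"
  have lin: "linear_on_mats d \<Phi>" and lin': "linear_on_mats d \<Phi>_adj"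
    using cp adj by (auto simp: completely_positive_def is_hs_adjoint_def)
  \<comment> \<open>E is the identity on the commutant, so the hypothesis on the composition with E
    says that the commutant is fixed pointwise.\<close>
  have fixed: "\<Phi>_adj y = y" if "y \<in> commutant d S" for y
  proof -
    have "E y = y" using E that by (simp add: conditional_expectation_def)
    then show ?thesis using \<Phi>E that by (metis (no_types, lifting) commutant_def mem_Collect_eq)
  qed
  obtain L where L: "Lip d S \<Phi> = ereal L" "0 \<le> L" "L < 1"
    using Lip Lip_nonneg[OF finite S lin] by (cases "Lip d S \<Phi>") auto
  obtain M where M: "Lip d S \<Phi>_adj = ereal M" "0 \<le> M" "M \<le> 1"
    using Lip' Lip_nonneg[OF finite S lin'] by (cases "Lip d S \<Phi>_adj") auto
  have sa: "self_adjoint (\<Phi> x)" if "x \<in> carrier_mat d d" "self_adjoint x" for x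
    using completely_positive_adjoint[OF cp un that(1)] that(2) by (simp add: self_adjoint_def)
  have bound: "trace_norm ((\<Phi> ^^ n) \<rho> - maximally_mixed d) \<le> real d * sqrt ((L * M) ^ n)"
    if "density_matrix d \<rho>" for n \<rho>
    using L M that
    by (intro trace_norm_iterate_le[OF d lin un tp sa]
        hs_norm_square_contraction[OF d cp tp un unique adj finite S fixed]) auto
  let ?R = "ereal 4 * (ereal (ln (1 / \<epsilon>) + ln (real d)) / (- elog (Lip d S \<Phi>) - elog (Lip d S \<Phi>_adj)))"
  show "t_mix d \<epsilon> \<Phi> \<le> max 1 ?R"
  \<comment> \<open>If the product is 0, the bound after one step is already 0. The denominator is
    then \<infinity> and the quotient 0, so the value 1 is supplied by the maximum.\<close>
  proof (cases "L * M = 0")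
    case True
    then have "t_mix d \<epsilon> \<Phi> \<le> ereal (real 1)"
      using order_trans[OF bound[of _ 1], of _ \<epsilon>] \<epsilon> by (intro t_mix_le) auto
    then show ?thesis by (simp add: le_max_iff_disj one_ereal_def)
  next
    case False
    then have pos: "0 < L" "0 < M" using L M by auto
    have "L * M \<le> L" using L M by (intro mult_left_le)
    then have q: "0 < L * M" "L * M < 1" using pos L(3) by (simp, linarith)
    obtain n where n: "n \<ge> 1" "real d * sqrt ((L * M) ^ n) \<le> \<epsilon>"
      "real n \<le> max 1 (4 * ((ln (1 / \<epsilon>) + ln (real d)) / - ln (L * M)))"
      using exists_power_le[OF q _ _ d] \<epsilon> by blast
    have "ln (L * M) < 0" using q by simp
    then have "?R = ereal (4 * ((ln (1 / \<epsilon>) + ln (real d)) / - ln (L * M)))"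
      using pos L M by (simp add: elog_def ln_mult algebra_simps)
    then have "ereal (real n) \<le> max 1 ?R"
      using n(3) by (simp only: le_max_iff_disj one_ereal_def ereal_less_eq)
    moreover have "t_mix d \<epsilon> \<Phi> \<le> ereal (real n)"
      using n(1) order_trans[OF bound n(2)] by (intro t_mix_le) auto
    ultimately show ?thesis by (rule order_trans[rotated])
  qed
qed simp

end
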